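(* Let $n\ge 1$ be an integer and let $\langle A\rangle$ and $\langle B\rangle$ be two nondegenerate semigroups in $\mathbb{N}^n$, finitely generated by $A=\{\mathbf{a}_1,\ldots,\mathbf{a}_p\}\subset\mathbb{N}^n$ and $B=\{\mathbf{b}_1,\ldots,\mathbf{b}_q\}\subset\mathbb{N}^n$ respectively, such that the semigroup rings $k[A]$ and $k[B]$ are Cohen-Macaulay. Then $\langle A\rangle$ and $\langle B\rangle$ can be glued if and only if $n=1$.
   Context: Here $\mathbb{N}=\{0,1,2,\ldots\}$ and $k$ is an arbitrary field. For nonzero vectors $\mathbf{a}_1,\ldots,\mathbf{a}_p\in\mathbb{N}^n$ and $A=\{\mathbf{a}_1,\ldots,\mathbf{a}_p\}$, $\langle A\rangle$ is the semigroup of all $\mathbb{N}$-linear combinations of elements of $A$; $I_A$ is the kernel of the $k$-algebra map $k[x_1,\ldots,x_p]\to k[t_1,\ldots,t_n]$, $x_j\mapsto t^{\mathbf{a}_j}=\prod_{i=1}^n t_i^{a_{ij}}$, where $\mathbf{a}_j=(a_{1j},\ldots,a_{nj})^T$; the semigroup ring is $k[A]\simeq k[x_1,\ldots,x_p]/I_A$. Similarly for $B=\{\mathbf{b}_1,\ldots,\mathbf{b}_q\}$, with variables $y_1,\ldots,y_q$, $I_B\subset k[y_1,\ldots,y_q]$ and $k[B]\simeq k[y_1,\ldots,y_q]/I_B$. All generators of semigroups are nonzero. The semigroup $\langle A\rangle\subset\mathbb{N}^n$ is nondegenerate if $\dim k[A]=n$ (Krull dimension), equivalently if the $n\times p$ integer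 matrix with columns $\mathbf{a}_1,\ldots,\mathbf{a}_p$ has rank $n$. For positive integers $k_1,k_2$ and $C=k_1A\cup k_2B$, let $I_C\subset R=k[x_1,\ldots,x_p,y_1,\ldots,y_q]$ be the kernel of the $k$-algebra map $R\to k[t_1,\ldots,t_n]$, $x_i\mapsto t^{k_1\mathbf{a}_i}$, $y_j\mapsto t^{k_2\mathbf{b}_j}$. One says that $\langle C\rangle$ is a gluing of $\langle A\rangle$ and $\langle B\rangle$ if $I_C=I_AR+I_BR+\langle\rho\rangle$ for some nonzero binomial $\rho=x_1^{\alpha_1}\cdots x_p^{\alpha_p}-y_1^{\beta_1}\cdots y_q^{\beta_q}$ with $\alpha\in\mathbb{N}^p$, $\beta\in\mathbb{N}^q$. The semigroups $\langle A\rangle$ and $\langle B\rangle$ can be glued if there exist positive integers $k_1,k_2$ such that, for $C=k_1A\cup k_2B$, $\langle C\rangle$ is a gluing of $\langle A\rangle$ and $\langle B\rangle$. *)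

theory Defs
  imports
    "HOL-Analysis.Finite_Cartesian_Product"
    "HOL-Library.Poly_Mapping"
    "HOL-Library.Extended_Nat"
    "HOL-Algebra.Algebra"
    "HOL-Algebra.Algebraic_Closure_Type"
begin

section \<open>Dimension, depth and Cohen-Macaulay rings\<close>

definition prime_chain :: "('a, 'b) ring_scheme \<Rightarrow> nat \<Rightarrow> (nat \<Rightarrow> 'a set) \<Rightarrow> bool" where
  "prime_chain R m P \<longleftrightarrow> (\<forall>i\<le>m. primeideal (P i) R) \<and> (\<forall>i<m. P i \<subset> P (Suc i))"

definition krull_dim :: "('a, 'b) ring_scheme \<Rightarrow> enat" where
  "krull_dim R = Sup {enat m | m. \<exists>P. prime_chain R m P}"

text \<open>The height (codimension) of a prime ideal.\<close>

definition height :: "('a, 'b) ring_scheme \<Rightarrow> 'a set \<Rightarrow> enat" where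
  "height R I = Sup {enat m | m. \<exists>P. prime_chain R m P \<and> P m = I}"

text \<open>A list \<open>xs\<close> is a regular sequence if it generates a proper ideal and every entry is a
  nonzerodivisor modulo the ideal generated by the preceding entries.\<close>

definition regular_seq :: "('a, 'b) ring_scheme \<Rightarrow> 'a list \<Rightarrow> bool" where
  "regular_seq R xs \<longleftrightarrow>
     set xs \<subseteq> carrier R \<and> Idl\<^bsub>R\<^esub> (set xs) \<noteq> carrier R \<and>
     (\<forall>i<length xs. \<forall>r\<in>carrier R.
        xs ! i \<otimes>\<^bsub>R\<^esub> r \<in> Idl\<^bsub>R\<^esub> (set (take i xs)) \<longrightarrow> r \<in> Idl\<^bsub>R\<^esub> (set (take i xs)))"

text \<open>The depth (grade) of \<open>R\<close> with respect to an ideal \<open>I\<close>.\<close>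

definition depth :: "('a, 'b) ring_scheme \<Rightarrow> 'a set \<Rightarrow> enat" where
  "depth R I = Sup {enat (length xs) | xs. regular_seq R xs \<and> set xs \<subseteq> I}"

text \<open>The definition of a (not necessarily local) Cohen-Macaulay ring as in Eisenbud,
  \<^emph>\<open>Commutative Algebra\<close>, Section 18.2.\<close>

definition cohen_macaulay :: "('a, 'b) ring_scheme \<Rightarrow> bool" where
  "cohen_macaulay R \<longleftrightarrow>
     cring R \<and> noetherian_ring R \<and> (\<forall>M. maximalideal M R \<longrightarrow> depth R M = height R M)"


section \<open>Polynomial rings\<close>

text \<open>Polynomials over \<open>'k\<close> in the variables indexed by \<open>'v\<close>; the keys of the outer mapping are
  the exponent vectors.\<close>

type_synonym ('v, 'k) mpoly = "('v \<Rightarrow>\<^sub>0 nat) \<Rightarrow>\<^sub>0 'k"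

definition mvar :: "'v \<Rightarrow> ('v, 'k::comm_ring_1) mpoly" where
  "mvar j = Poly_Mapping.single (Poly_Mapping.single j 1) 1"

definition mconst :: "'k \<Rightarrow> ('v, 'k::comm_ring_1) mpoly" where
  "mconst c = Poly_Mapping.single 0 c"

definition mmonom :: "('v::finite \<Rightarrow> nat) \<Rightarrow> ('v, 'k::comm_ring_1) mpoly" where
  "mmonom u = (\<Prod>j\<in>UNIV. mvar j ^ u j)"

text \<open>The homomorphism of \<open>'k\<close>-algebras that sends the variable \<open>j\<close> to \<open>g j\<close>.\<close>

definition msubst ::
  "('v::finite \<Rightarrow> ('w, 'k::comm_ring_1) mpoly) \<Rightarrow> ('v, 'k) mpoly \<Rightarrow> ('w, 'k) mpoly" where
  "msubst g f =
     (\<Sum>u\<in>Poly_Mapping.keys f.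
        mconst (Poly_Mapping.lookup f u) * (\<Prod>j\<in>UNIV. g j ^ Poly_Mapping.lookup u j))"

lemma mconst_1: "mconst 1 = 1"
  by (simp add: mconst_def)

lemma msubst_mvar: "msubst g (mvar j) = g j"
proof -
  have "(\<Prod>i\<in>UNIV. g i ^ Poly_Mapping.lookup (Poly_Mapping.single j (Suc 0)) i)
      = (\<Prod>i\<in>UNIV. if i = j then g i else 1)"
    by (rule prod.cong) (auto simp: lookup_single when_def)
  then show ?thesis
    by (simp add: msubst_def mvar_def mconst_1)
qed

abbreviation mpoly_ring :: "('v, 'k::comm_ring_1) mpoly ring" where
  "mpoly_ring \<equiv> ring_of_type_algebra"


section \<open>Semigroup rings and gluing\<close>

text \<open>A finite family \<open>a\<close> of vectors in \<open>nat ^ 'n\<close> stands for the generating set \<open>A = range a\<close>;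
  its index type also indexes the variables of the presenting polynomial ring.\<close>

definition toric_ideal :: "('p::finite \<Rightarrow> nat ^ 'n) \<Rightarrow> ('p, 'k::field) mpoly set" where
  "toric_ideal a =
     {f. msubst (\<lambda>j. mmonom (\<lambda>i. a j $ i)) f = (0 :: ('n, 'k) mpoly)}"

definition semigroup_ring :: "('p::finite \<Rightarrow> nat ^ 'n) \<Rightarrow> ('p, 'k::field) mpoly set ring" where
  "semigroup_ring a = mpoly_ring Quot toric_ideal a"

definition nondegenerate :: "'k::field itself \<Rightarrow> ('p::finite \<Rightarrow> nat ^ 'n) \<Rightarrow> bool" where
  "nondegenerate K a \<longleftrightarrow>
     krull_dim (semigroup_ring a :: ('p, 'k) mpoly set ring) = enat CARD('n)"

text \<open>The family of generators of \<open>C = k1 A \<union> k2 B\<close>. The variables of \<open>A\<close> and \<open>B\<close> stay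
  separate even if a vector belongs to both \<open>k1 A\<close> and \<open>k2 B\<close>.\<close>

definition glue_family ::
  "nat \<Rightarrow> nat \<Rightarrow> ('p \<Rightarrow> nat ^ 'n) \<Rightarrow> ('q \<Rightarrow> nat ^ 'n) \<Rightarrow> 'p + 'q \<Rightarrow> nat ^ 'n" where
  "glue_family k1 k2 a b = case_sum (\<lambda>i. k1 *s a i) (\<lambda>j. k2 *s b j)"

definition glue_binomial ::
  "('p::finite \<Rightarrow> nat) \<Rightarrow> ('q::finite \<Rightarrow> nat) \<Rightarrow> ('p + 'q, 'k::field) mpoly" where
  "glue_binomial \<alpha> \<beta> =
     (\<Prod>i\<in>UNIV. mvar (Inl i) ^ \<alpha> i) - (\<Prod>j\<in>UNIV. mvar (Inr j) ^ \<beta> j)"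

definition is_gluing ::
  "'k::field itself \<Rightarrow> nat \<Rightarrow> nat \<Rightarrow> ('p::finite \<Rightarrow> nat ^ 'n) \<Rightarrow> ('q::finite \<Rightarrow> nat ^ 'n) \<Rightarrow> bool" where
  "is_gluing K k1 k2 a b \<longleftrightarrow>
     (\<exists>\<alpha> \<beta>.
        let R = (mpoly_ring :: ('p + 'q, 'k) mpoly ring);
            \<rho> = glue_binomial \<alpha> \<beta>
        in \<rho> \<noteq> 0 \<and>
           toric_ideal (glue_family k1 k2 a b) =
             Idl\<^bsub>R\<^esub> (msubst (\<lambda>i. mvar (Inl i)) ` toric_ideal a) <+>\<^bsub>R\<^esub>
             Idl\<^bsub>R\<^esub> (msubst (\<lambda>j. mvar (Inr j)) ` toric_ideal b) <+>\<^bsub>R\<^esub>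
             Idl\<^bsub>R\<^esub> {\<rho>})"

definition can_be_glued ::
  "'k::field itself \<Rightarrow> ('p::finite \<Rightarrow> nat ^ 'n) \<Rightarrow> ('q::finite \<Rightarrow> nat ^ 'n) \<Rightarrow> bool" where
  "can_be_glued K a b \<longleftrightarrow> (\<exists>k1 k2. k1 > 0 \<and> k2 > 0 \<and> is_gluing K k1 k2 a b)"

end

theory Submission
  imports Defs "HOL-Analysis.Cartesian_Space"
begin

text \<open>If \<open>n \<noteq> 1\<close>, choose a nonzero integral functional \<open>l\<close> on \<open>\<int>\<^sup>n\<close> that vanishes on the
  \<open>A\<close>-degree of \<open>x\<^sup>\<alpha>\<close>. Applying \<open>l\<close> to the \<open>A\<close>-part of the degree
  gives a grading of \<open>R\<close> for which \<open>I\<^sub>A\<close>, \<open>I\<^sub>B\<close> and \<open>\<rho>\<close> are homogeneous, so in a gluing \<open>I\<^sub>C\<close> would be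
  homogeneous as well. But both lattices \<open>\<int>A\<close> and \<open>\<int>B\<close> have full rank, so they share a vector with
  \<open>l \<noteq> 0\<close>, and this yields an inhomogeneous binomial in \<open>I\<^sub>C\<close>.

  Full rank follows from \<open>dim k[A] = n\<close>: a chain of primes of length \<open>n\<close> produces \<open>n\<close> algebraically
  independent elements of \<open>k[A]\<close>, and counting their monomials of bounded degree shows that the
  exponents of \<open>k[A]\<close> do not lie in a hyperplane.

  If \<open>n = 1\<close>, the factors \<open>k1\<close> and \<open>k2\<close> can be chosen such that every binomial of \<open>I\<^sub>C\<close> only trades a
  multiple of \<open>\<alpha>\<close> for the same multiple of \<open>\<beta>\<close>, modulo \<open>I\<^sub>A\<close> and \<open>I\<^sub>B\<close>.\<close>

section \<open>Monomial maps and toric ideals\<close>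

text \<open>Pushforward of coefficients along \<open>\<delta>\<close>; for additive
  \<open>\<delta>\<close> it is the induced map of monoid algebras. The target is a bare type, so
  that choices of representatives and integer-valued degrees fit as well.\<close>

definition mon_map :: "('u \<Rightarrow> 'g) \<Rightarrow> ('u \<Rightarrow>\<^sub>0 'k::comm_monoid_add) \<Rightarrow> 'g \<Rightarrow>\<^sub>0 'k" where
  "mon_map \<delta> f = (\<Sum>u\<in>Poly_Mapping.keys f. Poly_Mapping.single (\<delta> u) (Poly_Mapping.lookup f u))"

lemma mon_map_superset:
  assumes "finite U" "Poly_Mapping.keys f \<subseteq> U"
  shows "mon_map \<delta> f = (\<Sum>u\<in>U. Poly_Mapping.single (\<delta> u) (Poly_Mapping.lookup f u))"
  unfolding mon_map_def using assms
  by (intro sum.mono_neutral_left) (auto simp: in_keys_iff)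

lemma mon_map_add: "mon_map \<delta> (f + g) = mon_map \<delta> f + mon_map \<delta> g"
proof -
  let ?U = "Poly_Mapping.keys f \<union> Poly_Mapping.keys g"
  have "Poly_Mapping.keys (f + g) \<subseteq> ?U"
    by (rule keys_add)
  then show ?thesis
    by (simp add: mon_map_superset[where U = ?U] lookup_add single_add sum.distrib)
qed

lemma mon_map_0 [simp]: "mon_map \<delta> 0 = 0"
  by (simp add: mon_map_def)

lemma mon_map_single [simp]: "mon_map \<delta> (Poly_Mapping.single u c) = Poly_Mapping.single (\<delta> u) c"
  by (cases "c = 0") (simp_all add: mon_map_def)

lemma mon_map_sum: "mon_map \<delta> (sum f U) = (\<Sum>u\<in>U. mon_map \<delta> (f u))"
  by (induction U rule: infinite_finite_induct) (simp_all add: mon_map_add)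

lemma mon_map_uminus: "mon_map \<delta> (- f) = - mon_map \<delta> (f :: 'u \<Rightarrow>\<^sub>0 'k::ab_group_add)"
  using mon_map_add[of \<delta> f "- f"] by (simp add: eq_neg_iff_add_eq_0 add.commute)

lemma mon_map_diff: "mon_map \<delta> (f - g) = mon_map \<delta> f - mon_map \<delta> (g :: 'u \<Rightarrow>\<^sub>0 'k::ab_group_add)"
  using mon_map_add[of \<delta> f "- g"] by (simp add: mon_map_uminus)

lemma mon_map_ident: "mon_map (\<lambda>u. u) f = f"
proof (rule poly_mapping_eqI)
  fix v
  show "Poly_Mapping.lookup (mon_map (\<lambda>u. u) f) v = Poly_Mapping.lookup f v"
    by (simp add: mon_map_def lookup_sum lookup_single when_def in_keys_iff)
qed

lemma mon_map_comp: "mon_map \<delta> (mon_map \<epsilon> f) = mon_map (\<lambda>u. \<delta> (\<epsilon> u)) f"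
  by (simp add: mon_map_def[of \<epsilon>] mon_map_def[of "\<lambda>u. \<delta> (\<epsilon> u)"] mon_map_sum)

lemma mon_map_mult:
  fixes \<delta> :: "'u::monoid_add \<Rightarrow> 'g::monoid_add" and f g :: "'u \<Rightarrow>\<^sub>0 'k::semiring_0"
  assumes "\<And>u v. \<delta> (u + v) = \<delta> u + \<delta> v"
  shows "mon_map \<delta> (f * g) = mon_map \<delta> f * mon_map \<delta> g"
proof -
  have "f * g = mon_map (\<lambda>u. u) f * mon_map (\<lambda>u. u) g"
    by (simp add: mon_map_ident)
  also have "mon_map \<delta> \<dots> = mon_map \<delta> f * mon_map \<delta> g"
    by (simp add: mon_map_def[of _ f] mon_map_def[of _ g] sum_product mult_single mon_map_sum assms)
  finally show ?thesis .
qed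

text \<open>For additive \<open>\<delta>\<close> the map is multiplicative. Applied both to toric
  ideals and to the kernel of the integer-valued degree that obstructs gluing.\<close>

lemma ideal_mon_map_kernel:
  fixes \<delta> :: "'u::comm_monoid_add \<Rightarrow> 'g::comm_monoid_add"
  assumes "\<And>u v. \<delta> (u + v) = \<delta> u + \<delta> v"
  shows "ideal {f :: 'u \<Rightarrow>\<^sub>0 'k::comm_ring_1. mon_map \<delta> f = 0} ring_of_type_algebra"
proof -
  let ?R = "ring_of_type_algebra :: ('u \<Rightarrow>\<^sub>0 'k) ring"
  interpret R: cring ?R
    by (rule cring_from_type_algebra)
  let ?G = "add_monoid ?R :: ('u \<Rightarrow>\<^sub>0 'k) monoid"
  have inv: "inv\<^bsub>?G\<^esub> f = - f" for f
    by (rule R.minus_equality[unfolded a_inv_def]) (simp_all add: ring_of_type_algebra_def)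
  have "subgroup {f. mon_map \<delta> f = 0} ?G"
  proof (rule subgroup.intro)
    fix f :: "'u \<Rightarrow>\<^sub>0 'k"
    assume "f \<in> {f. mon_map \<delta> f = 0}"
    then show "inv\<^bsub>?G\<^esub> f \<in> {f. mon_map \<delta> f = 0}"
      unfolding inv by (simp add: mon_map_uminus)
  qed (auto simp: ring_of_type_algebra_def mon_map_add)
  then show ?thesis
    by (rule idealI[OF R.ring_axioms]) (auto simp: ring_of_type_algebra_def mon_map_mult assms)
qed

text \<open>A monomial map identifies two monomials exactly when \<open>\<delta>\<close> does, so after subtracting from
  each term a chosen representative of its fibre nothing remains of a kernel element.\<close>

lemma mon_map_kernel_binomials:
  fixes \<delta> :: "'u::comm_monoid_add \<Rightarrow> 'g" and f :: "'u \<Rightarrow>\<^sub>0 'k::comm_ring_1"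
  assumes zero: "0 \<in> J"
    and add: "\<And>g h. g \<in> J \<Longrightarrow> h \<in> J \<Longrightarrow> g + h \<in> J"
    and mult: "\<And>g h. h \<in> J \<Longrightarrow> g * h \<in> J"
    and binom: "\<And>u v. \<delta> u = \<delta> v \<Longrightarrow> Poly_Mapping.single u 1 - Poly_Mapping.single v 1 \<in> J"
    and f: "mon_map \<delta> f = 0"
  shows "f \<in> J"
proof -
  let ?s = "\<lambda>u. inv_into UNIV \<delta> (\<delta> u)"
  have s: "\<delta> (?s u) = \<delta> u" for u
    by (simp add: f_inv_into_f)
  have "mon_map ?s f = mon_map (inv_into UNIV \<delta>) (mon_map \<delta> f)"
    by (simp add: mon_map_comp)
  then have "f = mon_map (\<lambda>u. u) f - mon_map ?s f"
    by (simp add: f mon_map_ident)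
  also have "\<dots> = (\<Sum>u\<in>Poly_Mapping.keys f. Poly_Mapping.single 0 (Poly_Mapping.lookup f u) *
      (Poly_Mapping.single u 1 - Poly_Mapping.single (?s u) 1))"
    by (simp add: mon_map_def sum_subtractf right_diff_distrib mult_single)
  also have "\<dots> \<in> J"
  proof (induction rule: infinite_finite_induct[of _ "Poly_Mapping.keys f"])
    case (insert u U)
    then show ?case
      by (simp add: add mult binom s)
  qed (simp_all add: zero)
  finally show ?thesis .
qed

section \<open>Substitutions of monomials as maps on exponent vectors\<close>

text \<open>Over a finite index type every function has finite support, so
  \<open>Abs_poly_mapping\<close> loses nothing.\<close>

definition mexp :: "('v::finite \<Rightarrow> nat) \<Rightarrow> 'v \<Rightarrow>\<^sub>0 nat" where
  "mexp w = Abs_poly_mapping w"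

lemma lookup_mexp [simp]: "Poly_Mapping.lookup (mexp w) = w"
  by (simp add: mexp_def)

lemma mexp_add: "mexp v + mexp w = mexp (\<lambda>i. v i + w i)"
  by (rule poly_mapping_eqI) (simp add: lookup_add)

lemma mexp_eq_iff [simp]: "mexp v = mexp w \<longleftrightarrow> v = w"
  by (metis lookup_mexp)

lemma single_mexp_power:
  "Poly_Mapping.single (mexp w) (1::'k::comm_ring_1) ^ n = Poly_Mapping.single (mexp (\<lambda>i. n * w i)) 1"
proof (induction n)
  case 0
  have "mexp (\<lambda>i. 0) = (0 :: 'a \<Rightarrow>\<^sub>0 nat)"
    by (rule poly_mapping_eqI) simp
  then show ?case
    by simp
qed (simp add: mult_single mexp_add)

lemma prod_single_mexp:
  "(\<Prod>j\<in>J. Poly_Mapping.single (mexp (w j)) (1::'k::comm_ring_1)) =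
     Poly_Mapping.single (mexp (\<lambda>i. \<Sum>j\<in>J. w j i)) 1"
proof -
  have "mexp (\<lambda>i. 0) = (0 :: 'a \<Rightarrow>\<^sub>0 nat)"
    by (rule poly_mapping_eqI) simp
  then show ?thesis
    by (induction J rule: infinite_finite_induct) (simp_all add: mult_single mexp_add)
qed

lemma mvar_eq: "mvar j = Poly_Mapping.single (mexp (\<lambda>i. if i = j then 1 else 0)) 1"
proof -
  have "mexp (\<lambda>i. if i = j then 1 else 0) = Poly_Mapping.single j 1"
    by (rule poly_mapping_eqI) (auto simp: lookup_single when_def)
  then show ?thesis
    by (simp add: mvar_def)
qed

text \<open>Sending variables to monomials acts linearly on exponents; hence every algebra map in
  the definitions of \<open>toric_ideal\<close> and \<open>is_gluing\<close> becomes a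
  \<open>mon_map\<close>.\<close>

lemma msubst_monomials:
  "msubst (\<lambda>j. Poly_Mapping.single (mexp (w j)) 1) f =
     mon_map (\<lambda>u. mexp (\<lambda>i. \<Sum>j\<in>UNIV. Poly_Mapping.lookup u j * w j i)) f"
  by (simp add: msubst_def mon_map_def single_mexp_power prod_single_mexp mconst_def mult_single)

lemma mmonom_eq: "mmonom w = Poly_Mapping.single (mexp w) 1"
  by (simp add: mmonom_def mvar_eq single_mexp_power prod_single_mexp if_distrib[of "(*) _"] sum.delta
      cong: if_cong)

definition tdeg :: "('p::finite \<Rightarrow> nat ^ 'n) \<Rightarrow> ('p \<Rightarrow>\<^sub>0 nat) \<Rightarrow> 'n \<Rightarrow>\<^sub>0 nat" where
  "tdeg a u = mexp (\<lambda>i. \<Sum>j\<in>UNIV. Poly_Mapping.lookup u j * a j $ i)"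

lemma tdeg_add: "tdeg a (u + v) = tdeg a u + tdeg a v"
  by (simp add: tdeg_def mexp_add lookup_add algebra_simps sum.distrib)

lemma toric_ideal_eq: "toric_ideal a = {f. mon_map (tdeg a) f = 0}"
  by (simp add: toric_ideal_def mmonom_eq msubst_monomials tdeg_def[abs_def])

lemma ideal_toric_ideal: "ideal (toric_ideal a) mpoly_ring"
  unfolding toric_ideal_eq by (rule ideal_mon_map_kernel) (rule tdeg_add)

definition inl_exp :: "('p::finite \<Rightarrow>\<^sub>0 nat) \<Rightarrow> 'p + 'q::finite \<Rightarrow>\<^sub>0 nat" where
  "inl_exp u = mexp (case_sum (Poly_Mapping.lookup u) (\<lambda>_. 0))"

definition inr_exp :: "('q::finite \<Rightarrow>\<^sub>0 nat) \<Rightarrow> 'p::finite + 'q \<Rightarrow>\<^sub>0 nat" where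
  "inr_exp v = mexp (case_sum (\<lambda>_. 0) (Poly_Mapping.lookup v))"

lemma msubst_Inl: "msubst (\<lambda>i. mvar (Inl i :: 'p::finite + 'q::finite)) f = mon_map inl_exp f"
proof -
  have "(\<lambda>i :: 'p + 'q. \<Sum>j\<in>UNIV. Poly_Mapping.lookup u j * (if i = Inl j then 1 else 0)) =
      case_sum (Poly_Mapping.lookup u) (\<lambda>_. 0)" for u :: "'p \<Rightarrow>\<^sub>0 nat"
    by (auto simp: fun_eq_iff if_distrib[of "(*) _"] split: sum.split cong: if_cong)
  then show ?thesis
    by (simp add: mvar_eq msubst_monomials inl_exp_def[abs_def])
qed

lemma msubst_Inr: "msubst (\<lambda>j. mvar (Inr j :: 'p::finite + 'q::finite)) f = mon_map inr_exp f"
proof -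
  have "(\<lambda>i :: 'p + 'q. \<Sum>j\<in>UNIV. Poly_Mapping.lookup u j * (if i = Inr j then 1 else 0)) =
      case_sum (\<lambda>_. 0) (Poly_Mapping.lookup u)" for u :: "'q \<Rightarrow>\<^sub>0 nat"
    by (auto simp: fun_eq_iff if_distrib[of "(*) _"] split: sum.split cong: if_cong)
  then show ?thesis
    by (simp add: mvar_eq msubst_monomials inr_exp_def[abs_def])
qed

lemma glue_binomial_eq:
  "glue_binomial \<alpha> \<beta> =
     Poly_Mapping.single (inl_exp (mexp \<alpha>)) 1 - Poly_Mapping.single (inr_exp (mexp \<beta>)) 1"
proof -
  have "(\<Prod>i\<in>UNIV. mvar (Inl i) ^ \<alpha> i) = (msubst (\<lambda>i. mvar (Inl i)) (Poly_Mapping.single (mexp \<alpha>) 1) :: ('a + 'b, 'c) mpoly)"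
    by (simp add: msubst_def mconst_1)
  moreover have "(\<Prod>i\<in>UNIV. mvar (Inr i) ^ \<beta> i) = (msubst (\<lambda>i. mvar (Inr i)) (Poly_Mapping.single (mexp \<beta>) 1) :: ('a + 'b, 'c) mpoly)"
    by (simp add: msubst_def mconst_1)
  ultimately show ?thesis
    by (simp add: glue_binomial_def msubst_Inl msubst_Inr)
qed

lemma sum_UNIV_sum_type:
  "(\<Sum>x\<in>(UNIV :: ('p::finite + 'q::finite) set). f x) = (\<Sum>i\<in>UNIV. f (Inl i)) + (\<Sum>j\<in>UNIV. f (Inr j))"
  by (subst UNIV_Plus_UNIV[symmetric], subst sum.Plus) simp_all

lemma lookup_tdeg_glue:
  "Poly_Mapping.lookup (tdeg (glue_family k1 k2 a b) w) t =
     k1 * (\<Sum>i\<in>UNIV. Poly_Mapping.lookup w (Inl i) * a i $ t) +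
     k2 * (\<Sum>j\<in>UNIV. Poly_Mapping.lookup w (Inr j) * b j $ t)"
  by (simp add: tdeg_def glue_family_def sum_UNIV_sum_type sum_distrib_left mult_ac)

section \<open>Chains of primes and algebraic independence\<close>

lemma primeideal_typeD:
  fixes P :: "'r::comm_ring_1 set"
  assumes "primeideal P ring_of_type_algebra"
  shows "0 \<in> P" and "x \<in> P \<Longrightarrow> y \<in> P \<Longrightarrow> x + y \<in> P" and "x \<in> P \<Longrightarrow> r * x \<in> P"
    and "x * y \<in> P \<Longrightarrow> x \<in> P \<or> y \<in> P" and "1 \<notin> P"
proof -
  interpret primeideal P ring_of_type_algebra
    by fact
  show "0 \<in> P" "x \<in> P \<Longrightarrow> y \<in> P \<Longrightarrow> x + y \<in> P" "x \<in> P \<Longrightarrow> r * x \<in> P"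
    "x * y \<in> P \<Longrightarrow> x \<in> P \<or> y \<in> P" "1 \<notin> P"
    using additive_subgroup.zero_closed[OF is_additive_subgroup]
      additive_subgroup.a_closed[OF is_additive_subgroup, of x y] I_l_closed[of x r] I_prime[of x y] I_notcarr one_imp_carrier
    by (auto simp: ring_of_type_algebra_def)
qed

text \<open>Exponents are lists, so that a new element in front of the list \<open>ys\<close>
  matches one step of the induction along a chain of primes.\<close>

definition exp_box :: "nat \<Rightarrow> nat \<Rightarrow> nat list set" where
  "exp_box m N = {w. set w \<subseteq> {..N} \<and> length w = m}"

lemma finite_exp_box [simp]: "finite (exp_box m N)"
  by (simp add: exp_box_def finite_lists_length_eq)

lemma card_exp_box: "card (exp_box m N) = Suc N ^ m"
  by (simp add: exp_box_def card_lists_length_eq)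

lemma exp_box_Suc: "exp_box (Suc m) N = (\<lambda>(i, w). i # w) ` ({..N} \<times> exp_box m N)"
  by (auto simp: exp_box_def length_Suc_conv image_iff)

lemma exp_box_0 [simp]: "exp_box 0 N = {[]}"
  by (auto simp: exp_box_def)

definition list_mon :: "'r::comm_ring_1 list \<Rightarrow> nat list \<Rightarrow> 'r" where
  "list_mon ys w = prod_list (map2 (^) ys w)"

lemma list_mon_simps [simp]:
  "list_mon [] w = 1" "list_mon (y # ys) (i # w) = y ^ i * list_mon ys w"
  by (simp_all add: list_mon_def)

text \<open>This is algebraic independence modulo \<open>P\<close>: every polynomial has its exponents in some box.\<close>

definition alg_indep_mod ::
  "('k::field \<Rightarrow> 'r::comm_ring_1) \<Rightarrow> 'r set \<Rightarrow> 'r list \<Rightarrow> bool" where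
  "alg_indep_mod \<kappa> P ys \<longleftrightarrow>
     (\<forall>N c. (\<Sum>w\<in>exp_box (length ys) N. \<kappa> (c w) * list_mon ys w) \<in> P \<longrightarrow>
        (\<forall>w\<in>exp_box (length ys) N. c w = 0))"

text \<open>If \<open>y \<in> Q - P\<close> satisfies a polynomial relation modulo \<open>P\<close>, then divide by the largest possible
  power of \<open>y\<close>; as \<open>y \<in> Q\<close>, the new constant coefficient lies in \<open>Q\<close>.\<close>

lemma alg_indep_mod_Cons:
  assumes P: "primeideal P ring_of_type_algebra" and Q: "primeideal Q ring_of_type_algebra"
    and "P \<subseteq> Q" and y: "y \<in> Q" "y \<notin> P" and \<kappa>: "\<kappa> 0 = 0" and ys: "alg_indep_mod \<kappa> Q ys"
  shows "alg_indep_mod \<kappa> P (y # ys)"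
  unfolding alg_indep_mod_def
proof (intro allI impI)
  fix N and c :: "nat list \<Rightarrow> 'b"
  note PD = primeideal_typeD[OF P] and QD = primeideal_typeD[OF Q]
  \<comment> \<open>\<open>g i\<close> collects the terms with exactly \<open>i\<close> factors
    \<open>y\<close>: the coefficient of \<open>y ^ i\<close>, itself an expression in
    \<open>ys\<close>.\<close>
  define g where "g i = (\<Sum>w\<in>exp_box (length ys) N. \<kappa> (c (i # w)) * list_mon ys w)" for i
  assume "(\<Sum>w\<in>exp_box (length (y # ys)) N. \<kappa> (c w) * list_mon (y # ys) w) \<in> P"
  also have "(\<Sum>w\<in>exp_box (length (y # ys)) N. \<kappa> (c w) * list_mon (y # ys) w) =
      (\<Sum>(i, w)\<in>{..N} \<times> exp_box (length ys) N. \<kappa> (c (i # w)) * (y ^ i * list_mon ys w))"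
    by (simp add: exp_box_Suc, subst sum.reindex) (auto simp: inj_on_def case_prod_unfold)
  also have "\<dots> = (\<Sum>i\<le>N. y ^ i * g i)"
    by (simp add: sum.cartesian_product[symmetric] g_def sum_distrib_left mult_ac)
  finally have rel: "(\<Sum>i\<le>N. y ^ i * g i) \<in> P" .
  have y_pow: "y ^ i \<notin> P" for i
    using PD(4,5) y by (induction i) auto
  \<comment> \<open>By strong induction the coefficients below \<open>i\<close> vanish, so
    \<open>y ^ i\<close> factors out of the relation and cancels modulo \<open>P\<close>. Modulo
    \<open>y\<close>, hence modulo \<open>Q\<close>, only \<open>g i\<close> survives, and
    independence modulo \<open>Q\<close> applies to it.\<close>
  have "\<forall>w\<in>exp_box (length ys) N. c (i # w) = 0" if "i \<le> N" for i
    using that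
  proof (induction i rule: less_induct)
    case (less i)
    have "y ^ i * (\<Sum>l\<in>{i..N}. y ^ (l - i) * g l) = (\<Sum>l\<in>{i..N}. y ^ l * g l)"
      unfolding sum_distrib_left
    proof (rule sum.cong)
      fix l
      assume "l \<in> {i..N}"
      then have "y ^ l = y ^ i * y ^ (l - i)"
        by (simp flip: power_add)
      then show "y ^ i * (y ^ (l - i) * g l) = y ^ l * g l"
        by (simp add: mult.assoc)
    qed simp
    also have "\<dots> = (\<Sum>l\<le>N. y ^ l * g l)"
      using less by (intro sum.mono_neutral_left) (auto simp: g_def \<kappa>)
    finally have "(\<Sum>l\<in>{i..N}. y ^ (l - i) * g l) \<in> Q"
      using rel PD(4)[of "y ^ i"] y_pow \<open>P \<subseteq> Q\<close> by auto
    moreover have "(\<Sum>l\<in>{i..N}. y ^ (l - i) * g l) = g i + (\<Sum>l\<in>{Suc i..N}. y ^ (l - i) * g l)"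
      using less.prems by (simp add: sum.atLeast_Suc_atMost)
    moreover have "(\<Sum>l\<in>{Suc i..N}. y ^ (l - i) * g l) =
        y * (\<Sum>l\<in>{Suc i..N}. y ^ (l - Suc i) * g l)"
      unfolding sum_distrib_left
    proof (rule sum.cong)
      fix l
      assume "l \<in> {Suc i..N}"
      then have "l - i = Suc (l - Suc i)"
        by auto
      then show "y ^ (l - i) * g l = y * (y ^ (l - Suc i) * g l)"
        by (simp add: mult.assoc)
    qed simp
    ultimately have "g i + y * (\<Sum>l\<in>{Suc i..N}. y ^ (l - Suc i) * g l) \<in> Q"
      by simp
    from QD(2)[OF this QD(3)[OF y(1), of "- (\<Sum>l\<in>{Suc i..N}. y ^ (l - Suc i) * g l)"]]
    have "g i \<in> Q"
      by (simp add: mult.commute)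
    then show ?case
      using ys unfolding alg_indep_mod_def g_def by (auto dest: spec[of _ "\<lambda>w. c (i # w)"])
  qed
  then show "\<forall>w\<in>exp_box (length (y # ys)) N. c w = 0"
    by (auto simp: exp_box_Suc)
qed

text \<open>Works down the chain: the top prime contains no nonzero constant, so the empty list is
  independent modulo it, and each step down prepends an element that separates two consecutive
  primes.\<close>

lemma prime_chain_imp_alg_indep:
  fixes Q :: "nat \<Rightarrow> 'r::comm_ring_1 set" and \<kappa> :: "'k::field \<Rightarrow> 'r"
  assumes "prime_chain ring_of_type_algebra m Q"
    and \<kappa>: "\<kappa> 0 = 0" "\<kappa> 1 = 1" "\<And>x y. \<kappa> (x * y) = \<kappa> x * \<kappa> y"
  shows "\<exists>ys. length ys = m \<and> alg_indep_mod \<kappa> (Q 0) ys"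
  using assms(1)
proof (induction m arbitrary: Q)
  case 0
  then have P: "primeideal (Q 0) ring_of_type_algebra"
    by (simp add: prime_chain_def)
  have "x = 0" if "\<kappa> x \<in> Q 0" for x
  proof (rule ccontr)
    assume "x \<noteq> 0"
    then have "1 = \<kappa> (inverse x) * \<kappa> x"
      by (simp add: \<kappa>(2) flip: \<kappa>(3))
    then show False
      using primeideal_typeD(3,5)[OF P] that by metis
  qed
  then have "alg_indep_mod \<kappa> (Q 0) []"
    by (simp add: alg_indep_mod_def)
  then show ?case
    by blast
next
  case (Suc m)
  then have "prime_chain ring_of_type_algebra m (\<lambda>i. Q (Suc i))"
    by (simp add: prime_chain_def)
  from Suc.IH[OF this] obtain ys where ys: "length ys = m" "alg_indep_mod \<kappa> (Q (Suc 0)) ys"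
    by blast
  have chain: "primeideal (Q 0) ring_of_type_algebra" "primeideal (Q (Suc 0)) ring_of_type_algebra"
    "Q 0 \<subset> Q (Suc 0)"
    using Suc.prems by (simp_all add: prime_chain_def)
  then obtain y where "y \<in> Q (Suc 0)" "y \<notin> Q 0"
    by blast
  with chain ys \<kappa>(1) have "alg_indep_mod \<kappa> (Q 0) (y # ys)"
    by (intro alg_indep_mod_Cons[of _ "Q (Suc 0)"]) auto
  with ys show ?case
    by (metis length_Cons)
qed

text \<open>Gaussian elimination: a nonzero entry \<open>M v e\<close> serves as a pivot that
  removes the equation \<open>e\<close> together with the unknown \<open>v\<close>.\<close>

lemma homogeneous_system_nontrivial:
  fixes M :: "'w \<Rightarrow> 'e \<Rightarrow> 'k::field"
  assumes "finite E" "finite W" "card E < card W"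
  shows "\<exists>c. (\<exists>w\<in>W. c w \<noteq> 0) \<and> (\<forall>e\<in>E. (\<Sum>w\<in>W. c w * M w e) = 0)"
  using assms
proof (induction E arbitrary: W M rule: finite_induct)
  case empty
  then obtain w where "w \<in> W"
    by fastforce
  then show ?case
    by (intro exI[of _ "\<lambda>_. 1"]) auto
next
  case (insert e E)
  show ?case
  proof (cases "\<forall>w\<in>W. M w e = 0")
    case True
    have "card E < card W"
      using insert.hyps insert.prems(2) by simp
    then obtain c where "\<exists>w\<in>W. c w \<noteq> 0" "\<forall>x\<in>E. (\<Sum>w\<in>W. c w * M w x) = 0"
      using insert.IH[OF insert.prems(1), of M] by blast
    with True show ?thesis
      by (intro exI[of _ c]) auto
  next
    case False
    then obtain v where v: "v \<in> W" "M v e \<noteq> 0"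
      by blast
    let ?W = "W - {v}"
    have W: "finite ?W" "card E < card ?W"
      using insert v by auto
    obtain c where c: "\<exists>w\<in>?W. c w \<noteq> 0"
      "\<And>x. x \<in> E \<Longrightarrow> (\<Sum>w\<in>?W. c w * (M w x - M w e / M v e * M v x)) = 0"
      using insert.IH[OF W, of "\<lambda>w x. M w x - M w e / M v e * M v x"] by blast
    \<comment> \<open>The value of the pivot unknown that equation \<open>e\<close> forces.\<close>
    define s where "s = - (\<Sum>w\<in>?W. c w * M w e / M v e)"
    define d where "d = c(v := s)"
    have d: "(\<Sum>w\<in>W. d w * M w x) = s * M v x + (\<Sum>w\<in>?W. c w * M w x)" for x
      using v insert.prems by (simp add: sum.remove[of W v] d_def)
    have "(\<Sum>w\<in>W. d w * M w e) = 0"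
      using v by (simp add: d s_def sum_distrib_right)
    moreover have "(\<Sum>w\<in>W. d w * M w x) = 0" if "x \<in> E" for x
      using c(2)[OF that]
      by (simp add: d s_def sum_distrib_right right_diff_distrib sum_subtractf mult.assoc)
    moreover have "\<exists>w\<in>W. d w \<noteq> 0"
      using c(1) by (auto simp: d_def)
    ultimately show ?thesis
      by blast
  qed
qed

section \<open>The dimension of a semigroup ring\<close>

text \<open>Longer chains truncate, so without a chain of length \<open>n\<close> all lengths stay
  below \<open>n\<close>. For \<open>n = 0\<close> the supremum could be that of the empty set,
  whence \<open>n > 0\<close>.\<close>

lemma krull_dim_eq_enat_imp_prime_chain:
  assumes "krull_dim R = enat n" "n > 0"
  shows "\<exists>P. prime_chain R n P"
proof (rule ccontr)
  assume no_chain: "\<nexists>P. prime_chain R n P"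
  have "m < n" if "prime_chain R m P" for m P
  proof (rule ccontr)
    assume "\<not> m < n"
    with that have "prime_chain R n P"
      by (simp add: prime_chain_def)
    with no_chain show False
      by blast
  qed
  then have "krull_dim R \<le> enat (n - 1)"
    unfolding krull_dim_def by (intro Sup_least) fastforce
  with assms show False
    by simp
qed

text \<open>Preimages under the projection; its surjectivity keeps the inclusions strict. As the
  lowest preimage contains \<open>I\<close>, relations that hold in the quotient also hold modulo
  that prime.\<close>

lemma prime_chain_quotient:
  assumes "cring R" "ideal I R" "prime_chain (R Quot I) m P"
  shows "prime_chain R m (\<lambda>i. {r \<in> carrier R. I +>\<^bsub>R\<^esub> r \<in> P i})"
    and "I \<subseteq> {r \<in> carrier R. I +>\<^bsub>R\<^esub> r \<in> P 0}"
proof -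
  interpret ideal I R
    by fact
  interpret h: ring_hom_ring R "R Quot I" "(+>\<^bsub>R\<^esub>) I"
    by (rule rcos_ring_hom_ring)
  have prime: "primeideal (P i) (R Quot I)" if "i \<le> m" for i
    using assms(3) that by (simp add: prime_chain_def)
  have "{r \<in> carrier R. I +>\<^bsub>R\<^esub> r \<in> P i} \<subset> {r \<in> carrier R. I +>\<^bsub>R\<^esub> r \<in> P (Suc i)}" if "i < m" for i
  proof -
    have sub: "P i \<subset> P (Suc i)"
      using assms(3) that by (simp add: prime_chain_def)
    then obtain x where x: "x \<in> P (Suc i)" "x \<notin> P i"
      by blast
    have "x \<in> carrier (R Quot I)"
      using ideal.Icarr[OF primeideal.axioms(1)[OF prime[of "Suc i"]]] x(1) that by simp
    then have "x \<in> a_rcosets\<^bsub>R\<^esub> I"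
      by (simp only: FactRing_def partial_object.simps)
    then obtain r where "r \<in> carrier R" "x = I +>\<^bsub>R\<^esub> r"
      unfolding A_RCOSETS_def' by blast
    with sub x show ?thesis
      by blast
  qed
  with prime show "prime_chain R m (\<lambda>i. {r \<in> carrier R. I +>\<^bsub>R\<^esub> r \<in> P i})"
    unfolding prime_chain_def using h.primeideal_vimage[OF assms(1)] by blast
  have "\<zero>\<^bsub>R Quot I\<^esub> \<in> P 0"
    by (intro additive_subgroup.zero_closed ideal.axioms(1) primeideal.axioms(1) prime le0)
  then have "I \<in> P 0"
    by (simp only: FactRing_def ring.simps)
  moreover have "I +>\<^bsub>R\<^esub> r = I" if "r \<in> I" for r
    by (rule a_coset_join2[OF Icarr[OF that] a_subgroup that])
  ultimately show "I \<subseteq> {r \<in> carrier R. I +>\<^bsub>R\<^esub> r \<in> P 0}"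
    using Icarr by auto
qed

section \<open>Counting monomials on a hyperplane\<close>

text \<open>The bound \<open>K\<close> acts as a degree: it adds up under multiplication and leaves
  finitely many exponents.\<close>

definition hyperplane_polys :: "('n::finite \<Rightarrow> rat) \<Rightarrow> nat \<Rightarrow> ('n, 'k::comm_ring_1) mpoly set" where
  "hyperplane_polys c K =
     {f. \<forall>e\<in>Poly_Mapping.keys f. (\<Sum>i\<in>UNIV. c i * of_nat (Poly_Mapping.lookup e i)) = 0 \<and>
           (\<forall>i. Poly_Mapping.lookup e i \<le> K)}"

lemma hyperplane_polys_one: "1 \<in> hyperplane_polys c K"
  by (simp add: hyperplane_polys_def)

lemma hyperplane_polys_mono: "K \<le> L \<Longrightarrow> hyperplane_polys c K \<subseteq> hyperplane_polys c L"
  by (fastforce simp: hyperplane_polys_def intro: order_trans)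

lemma hyperplane_polys_mult:
  assumes f: "f \<in> hyperplane_polys c K" and g: "g \<in> hyperplane_polys c L"
  shows "f * g \<in> hyperplane_polys c (K + L)"
  unfolding hyperplane_polys_def
proof (rule CollectI, rule ballI)
  fix e
  assume "e \<in> Poly_Mapping.keys (f * g)"
  then obtain u v where e: "e = u + v" "u \<in> Poly_Mapping.keys f" "v \<in> Poly_Mapping.keys g"
    using keys_mult[of f g] by auto
  then show "(\<Sum>i\<in>UNIV. c i * of_nat (Poly_Mapping.lookup e i)) = 0 \<and>
      (\<forall>i. Poly_Mapping.lookup e i \<le> K + L)"
    using f g by (auto simp: hyperplane_polys_def lookup_add distrib_left sum.distrib add_mono)
qed

lemma hyperplane_polys_list_mon:
  assumes "set zs \<subseteq> hyperplane_polys c D"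
  shows "list_mon zs w \<in> hyperplane_polys c (D * sum_list w)"
  using assms
proof (induction zs arbitrary: w)
  case Nil
  then show ?case
    by (simp add: hyperplane_polys_one)
next
  case (Cons z zs)
  have power: "z ^ i \<in> hyperplane_polys c (D * i)" for i
  proof (induction i)
    case (Suc i)
    then show ?case
      using Cons.prems hyperplane_polys_mult[of z c D "z ^ i"] by simp
  qed (simp add: hyperplane_polys_one)
  show ?case
  proof (cases w)
    case Nil
    then show ?thesis
      by (simp add: list_mon_def hyperplane_polys_one)
  next
    case (Cons i w')
    then show ?thesis
      using hyperplane_polys_mult[OF power Cons.IH] Cons.prems by (simp add: distrib_left)
  qed
qed

text \<open>As \<open>c t\<close> is nonzero, the coordinate \<open>t\<close> of a point is
  determined by the others, so forgetting it embeds the points into a box of one dimension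
  less.\<close>

lemma card_hyperplane_points:
  fixes c :: "'n::finite \<Rightarrow> rat" and K :: nat
  assumes "c t \<noteq> 0"
  defines "E \<equiv> {e :: 'n \<Rightarrow>\<^sub>0 nat. (\<Sum>i\<in>UNIV. c i * of_nat (Poly_Mapping.lookup e i)) = 0 \<and>
      (\<forall>i. Poly_Mapping.lookup e i \<le> K)}"
  shows "finite E" and "card E \<le> Suc K ^ (CARD('n) - 1)"
proof -
  let ?F = "(UNIV - {t}) \<rightarrow>\<^sub>E {..K}"
  let ?r = "\<lambda>e :: 'n \<Rightarrow>\<^sub>0 nat. restrict (Poly_Mapping.lookup e) (UNIV - {t})"
  have fin: "finite ?F"
    by (rule finite_PiE) auto
  have "inj_on ?r E"
  proof (rule inj_onI)
    fix d e
    assume de: "d \<in> E" "e \<in> E" "?r d = ?r e"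
    then have other: "Poly_Mapping.lookup d i = Poly_Mapping.lookup e i" if "i \<noteq> t" for i
      using that by (metis DiffI UNIV_I restrict_apply' singletonD)
    have "(\<Sum>i\<in>UNIV - {t}. c i * of_nat (Poly_Mapping.lookup d i)) =
        (\<Sum>i\<in>UNIV - {t}. c i * of_nat (Poly_Mapping.lookup e i))"
      by (rule sum.cong) (simp_all add: other)
    moreover have "c t * of_nat (Poly_Mapping.lookup e t) +
        (\<Sum>i\<in>UNIV - {t}. c i * of_nat (Poly_Mapping.lookup e i)) = 0" if "e \<in> E" for e
      using that by (simp add: E_def sum.remove[of UNIV t])
    ultimately have "c t * of_nat (Poly_Mapping.lookup d t) = c t * of_nat (Poly_Mapping.lookup e t)"
      using de(1,2) by (metis add_right_cancel)
    with \<open>c t \<noteq> 0\<close> have "Poly_Mapping.lookup d t = Poly_Mapping.lookup e t"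
      by simp
    with other show "d = e"
      by (metis poly_mapping_eqI)
  qed
  moreover have "?r ` E \<subseteq> ?F"
    by (auto simp: E_def split: if_splits)
  ultimately show "finite E" "card E \<le> Suc K ^ (CARD('n) - 1)"
    using fin inj_on_finite[of ?r E ?F] card_inj_on_le[of ?r E ?F]
    by (simp_all add: card_PiE card_Diff_singleton)
qed

text \<open>There are \<open>(N + 1)\<^sup>n\<close> exponents in the box, but their monomials only involve
  \<open>O(N\<^sup>n\<^sup>-\<^sup>1)\<close> lattice points of the hyperplane.\<close>

lemma hyperplane_polys_not_alg_indep:
  fixes zs :: "('n::finite, 'k::field) mpoly list"
  assumes "c t \<noteq> 0" and zs: "set zs \<subseteq> hyperplane_polys c D" and len: "length zs = CARD('n)"
  shows "\<not> alg_indep_mod mconst {0} zs"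
proof -
  define n where "n = CARD('n)"
  \<comment> \<open>All exponents that occur are at most \<open>K\<close>, and
    \<open>K + 1 \<le> L * (N + 1)\<close>. The choice of \<open>N\<close> turns the bound
    \<open>(L * (N + 1)) ^ (n - 1)\<close> into \<open>N * (N + 1) ^ (n - 1)\<close>, just below the
    size \<open>(N + 1) ^ n\<close> of the box.\<close>
  define L where "L = D * n + 1"
  define N where "N = L ^ (n - 1)"
  define K where "K = D * (n * N)"
  define E where "E = {e :: 'n \<Rightarrow>\<^sub>0 nat. (\<Sum>i\<in>UNIV. c i * of_nat (Poly_Mapping.lookup e i)) = 0 \<and>
      (\<forall>i. Poly_Mapping.lookup e i \<le> K)}"
  have mem: "list_mon zs w \<in> hyperplane_polys c K" if "w \<in> exp_box n N" for w
  proof -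
    have "sum_list w \<le> n * N"
      using that sum_list_mono[of w "\<lambda>x. x" "\<lambda>_. N"]
      by (auto simp: exp_box_def sum_list_triv)
    then have "D * sum_list w \<le> K"
      by (simp add: K_def)
    then show ?thesis
      using hyperplane_polys_list_mon[OF zs, of w] hyperplane_polys_mono by blast
  qed
  have "finite E" and "card E \<le> Suc K ^ (n - 1)"
    unfolding E_def n_def by (fact card_hyperplane_points[where t = t and c = c, OF assms(1)])+
  note this(2)
  also have "Suc K ^ (n - 1) \<le> (L * Suc N) ^ (n - 1)"
    by (intro power_mono) (simp_all add: K_def L_def algebra_simps)
  also have "\<dots> = N * Suc N ^ (n - 1)"
    by (simp only: power_mult_distrib N_def)
  also have "\<dots> < Suc N * Suc N ^ (n - 1)"
    by simp
  also have "\<dots> = card (exp_box n N)"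
    by (simp add: card_exp_box n_def flip: power_Suc)
  \<comment> \<open>The unknowns are the coefficients of the monomials in \<open>zs\<close>, with
    one equation for each lattice point of \<open>E\<close>.\<close>
  finally obtain d where d: "\<exists>w\<in>exp_box n N. d w \<noteq> 0"
    "\<And>e. e \<in> E \<Longrightarrow> (\<Sum>w\<in>exp_box n N. d w * Poly_Mapping.lookup (list_mon zs w) e) = 0"
    using homogeneous_system_nontrivial[OF \<open>finite E\<close> finite_exp_box,
        of n N "\<lambda>w. Poly_Mapping.lookup (list_mon zs w)"] by blast
  have "(\<Sum>w\<in>exp_box n N. mconst (d w) * list_mon zs w) = 0"
  proof (rule poly_mapping_eqI)
    fix e
    have "Poly_Mapping.lookup (\<Sum>w\<in>exp_box n N. mconst (d w) * list_mon zs w) e =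
        (\<Sum>w\<in>exp_box n N. d w * Poly_Mapping.lookup (list_mon zs w) e)"
      by (simp add: lookup_sum mconst_def flip: mult_map_scale_conv_mult)
        (auto simp: Poly_Mapping.map.rep_eq when_def intro!: sum.cong)
    also have "\<dots> = 0"
    proof (cases "e \<in> E")
      case False
      then have "Poly_Mapping.lookup (list_mon zs w) e = 0" if "w \<in> exp_box n N" for w
        using mem[OF that] by (auto simp: hyperplane_polys_def E_def in_keys_iff)
      then show ?thesis
        by simp
    qed (rule d(2))
    finally show "Poly_Mapping.lookup (\<Sum>w\<in>exp_box n N. mconst (d w) * list_mon zs w) e =
        Poly_Mapping.lookup 0 e"
      by simp
  qed
  with d(1) len show ?thesis
    by (auto simp: alg_indep_mod_def n_def)
qed

lemma mon_map_list_mon: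
  fixes ys :: "('u::comm_monoid_add \<Rightarrow>\<^sub>0 'k::comm_ring_1) list"
    and \<delta> :: "'u \<Rightarrow> 'g::comm_monoid_add"
  assumes add: "\<And>u v. \<delta> (u + v) = \<delta> u + \<delta> v" and zero: "\<delta> 0 = 0"
  shows "mon_map \<delta> (list_mon ys w) = list_mon (map (mon_map \<delta>) ys) w"
proof -
  have one: "mon_map \<delta> (1 :: 'u \<Rightarrow>\<^sub>0 'k) = 1"
    using mon_map_single[of \<delta> 0 "1::'k"] by (simp add: zero)
  have power: "mon_map \<delta> (f ^ i) = mon_map \<delta> f ^ i" for f :: "'u \<Rightarrow>\<^sub>0 'k" and i
    by (induction i) (simp_all add: one mon_map_mult[OF add])
  show ?thesis
  proof (induction ys arbitrary: w)
    case (Cons y ys)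
    then show ?case
      by (cases w) (simp_all add: one power mon_map_mult[OF add] list_mon_def)
  qed (simp add: one)
qed

text \<open>This says that the matrix of \<open>a\<close> has rank n. Independent elements from a
  chain of primes map under \<open>tdeg a\<close> to independent polynomials, yet all their
  exponents would lie on the hyperplane of \<open>c\<close>.\<close>

lemma nondegenerate_no_annihilator:
  fixes a :: "'p::finite \<Rightarrow> nat ^ 'n" and c :: "'n \<Rightarrow> rat"
  assumes nd: "nondegenerate TYPE('k::field) a"
    and c: "\<And>j. (\<Sum>i\<in>UNIV. c i * of_nat (a j $ i)) = 0"
  shows "c t = 0"
proof (rule ccontr)
  assume "c t \<noteq> 0"
  let ?R = "mpoly_ring :: ('p, 'k) mpoly ring"
  let ?I = "toric_ideal a :: ('p, 'k) mpoly set"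
  obtain P where P: "prime_chain (?R Quot ?I) CARD('n) P"
    using krull_dim_eq_enat_imp_prime_chain nd
    unfolding nondegenerate_def semigroup_ring_def by (metis zero_less_card_finite)
  define Q where "Q i = {r \<in> carrier ?R. ?I +>\<^bsub>?R\<^esub> r \<in> P i}" for i
  have chain: "prime_chain ?R CARD('n) Q" and "?I \<subseteq> Q 0"
    using prime_chain_quotient[OF cring_from_type_algebra ideal_toric_ideal P]
    unfolding Q_def by auto
  obtain ys where ys: "length ys = CARD('n)" "alg_indep_mod mconst (Q 0) ys"
    using prime_chain_imp_alg_indep[OF chain, of mconst]
    by (auto simp: mconst_def mult_single)
  define zs where "zs = map (mon_map (tdeg a)) ys"
  have tdeg_0: "tdeg a 0 = 0"
    by (rule poly_mapping_eqI) (simp add: tdeg_def)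
  have tdeg_c: "(\<Sum>i\<in>UNIV. c i * of_nat (Poly_Mapping.lookup (tdeg a u) i)) = 0" for u
  proof -
    have "(\<Sum>i\<in>UNIV. c i * of_nat (Poly_Mapping.lookup (tdeg a u) i)) =
        (\<Sum>j\<in>UNIV. of_nat (Poly_Mapping.lookup u j) * (\<Sum>i\<in>UNIV. c i * of_nat (a j $ i)))"
      unfolding sum_distrib_left by (subst sum.swap) (simp add: tdeg_def sum_distrib_left mult_ac)
    then show ?thesis
      by (simp add: c)
  qed
  have "\<exists>D. mon_map (tdeg a) y \<in> hyperplane_polys c D" for y :: "('p, 'k) mpoly"
  proof -
    let ?K = "Poly_Mapping.keys (mon_map (tdeg a) y)"
    have "?K \<subseteq> range (tdeg a)"
      unfolding mon_map_def by (rule order_trans[OF keys_sum]) auto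
    moreover have "Poly_Mapping.lookup e i \<le> (\<Sum>e\<in>?K. \<Sum>i\<in>UNIV. Poly_Mapping.lookup e i)"
      if "e \<in> ?K" for e i
      using that by (intro order_trans[OF member_le_sum[of i UNIV] member_le_sum[of e ?K]]) auto
    ultimately show ?thesis
      using tdeg_c unfolding hyperplane_polys_def by blast
  qed
  then obtain D where D: "mon_map (tdeg a) y \<in> hyperplane_polys c (D y)" for y :: "('p, 'k) mpoly"
    by metis
  have "set zs \<subseteq> hyperplane_polys c (\<Sum>y\<in>set ys. D y)"
    using D hyperplane_polys_mono[OF member_le_sum[of _ "set ys" D], of _ c]
    by (fastforce simp: zs_def)
  \<comment> \<open>A relation among the images lifts to an element of the toric ideal, hence of
    \<open>Q 0\<close>.\<close>
  moreover have "alg_indep_mod mconst {0} zs"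
    unfolding alg_indep_mod_def
  proof (intro allI impI)
    fix N and d :: "nat list \<Rightarrow> 'k"
    assume "(\<Sum>w\<in>exp_box (length zs) N. mconst (d w) * list_mon zs w) \<in> {0}"
    also have "(\<Sum>w\<in>exp_box (length zs) N. mconst (d w) * list_mon zs w) =
        mon_map (tdeg a) (\<Sum>w\<in>exp_box (length ys) N. mconst (d w) * list_mon ys w)"
      by (simp add: mon_map_sum mon_map_mult[OF tdeg_add] mon_map_list_mon[OF tdeg_add tdeg_0]
          zs_def mconst_def tdeg_0)
    finally have "(\<Sum>w\<in>exp_box (length ys) N. mconst (d w) * list_mon ys w) \<in> ?I"
      by (simp add: toric_ideal_eq)
    with \<open>?I \<subseteq> Q 0\<close> ys(2) show "\<forall>w\<in>exp_box (length zs) N. d w = 0"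
      unfolding alg_indep_mod_def zs_def by auto
  qed
  ultimately show False
    using hyperplane_polys_not_alg_indep[of c t zs] \<open>c t \<noteq> 0\<close> ys(1) by (simp add: zs_def)
qed

section \<open>Obstruction to gluing\<close>

text \<open>If the rational span \<open>V\<close> of the vectors were proper, a basis of
  \<open>V\<close> would impose fewer than n equations on n coefficients, and a nonzero functional
  would annihilate the family.\<close>

lemma rational_combination_unit_vector:
  fixes a :: "'p::finite \<Rightarrow> nat ^ 'n"
  assumes "\<And>(c :: 'n \<Rightarrow> rat) i. (\<And>j. (\<Sum>i\<in>UNIV. c i * of_nat (a j $ i)) = 0) \<Longrightarrow> c i = 0"
  shows "\<exists>r :: 'p \<Rightarrow> rat. \<forall>i. (\<Sum>j\<in>UNIV. r j * of_nat (a j $ i)) = (if i = t then 1 else 0)"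
proof -
  define F :: "('p \<Rightarrow> rat) \<Rightarrow> rat ^ 'n" where
    "F r = (\<chi> i. \<Sum>j\<in>UNIV. r j * of_nat (a j $ i))" for r
  define V where "V = range F"
  have F_add: "F r + F s = F (\<lambda>j. r j + s j)" for r s
    by (simp add: F_def vec_eq_iff distrib_right sum.distrib)
  have F_scale: "q *s F r = F (\<lambda>j. q * r j)" for q r
    by (simp add: F_def vec_eq_iff sum_distrib_left mult.assoc)
  have F_0: "F (\<lambda>_. 0) = 0"
    by (simp add: F_def vec_eq_iff)
  have subspace: "vec.subspace V"
    unfolding vec.subspace_def V_def by (auto simp: F_add F_scale simp flip: F_0)
  obtain S where S: "S \<subseteq> V" "vec.independent S" "V \<subseteq> vec.span S" "card S = vec.dim V"
    using vec.basis_exists by blast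
  have "vec.dim V = CARD('n)"
  proof (rule ccontr)
    assume "vec.dim V \<noteq> CARD('n)"
    then have "card S < card (UNIV :: 'n set)"
      using S(4) vec.dim_subset_UNIV[of V] by (simp add: vec.dimension_def card_cart_basis)
    then obtain c where c: "\<exists>i. c i \<noteq> 0" "\<And>x. x \<in> S \<Longrightarrow> (\<Sum>i\<in>UNIV. c i * x $ i) = 0"
      using homogeneous_system_nontrivial[OF vec.finiteI_independent[OF S(2)] finite_class.finite_UNIV,
          of "\<lambda>i x. vec_nth x i"] by auto
    have "vec.subspace {x. (\<Sum>i\<in>UNIV. c i * x $ i) = 0}"
      by (auto simp: vec.subspace_def distrib_left sum.distrib mult.left_commute
          simp flip: sum_distrib_left)
    then have "vec.span S \<subseteq> {x. (\<Sum>i\<in>UNIV. c i * x $ i) = 0}"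
      using c(2) by (intro vec.span_minimal) auto
    moreover have "F (\<lambda>l. if l = j then 1 else 0) = (\<chi> i. of_nat (a j $ i))" for j
      by (simp add: F_def vec_eq_iff if_distrib[of "\<lambda>x. x * _"] cong: if_cong)
    then have "(\<chi> i. of_nat (a j $ i)) \<in> V" for j
      unfolding V_def by (metis rangeI)
    ultimately have "(\<Sum>i\<in>UNIV. c i * of_nat (a j $ i)) = 0" for j
      using S(3) by fastforce
    with assms[of c] c(1) show False
      by blast
  qed
  then have "vec.span V = UNIV"
    using vec.dim_eq_full[of V] by (simp add: vec.dimension_def card_cart_basis)
  then have "V = UNIV"
    using subspace vec.span_eq_iff by metis
  then obtain r where "F r = axis t 1"
    unfolding V_def by (metis UNIV_I imageE)
  then have "F r $ i = axis t 1 $ i" for i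
    by simp
  then show ?thesis
    unfolding F_def axis_def by (intro exI[of _ r]) simp
qed

text \<open>Clears denominators and splits the integers into positive and negative parts, since
  exponents of monomials must be natural numbers.\<close>

lemma common_denominator:
  fixes r :: "'p::finite \<Rightarrow> rat"
  shows "\<exists>d>0. \<exists>u v :: 'p \<Rightarrow> nat. \<forall>j. of_nat d * r j = of_nat (u j) - of_nat (v j)"
proof -
  define D where "D j = nat (snd (quotient_of (r j)))" for j
  define d where "d = (\<Prod>j\<in>UNIV. D j)"
  have D: "D j > 0" for j
    by (simp add: D_def quotient_of_denom_pos')
  have "\<exists>z. of_nat d * r j = of_int z" for j
  proof -
    have "r j = of_int (fst (quotient_of (r j))) / of_nat (D j)"
      using quotient_of_div[of "r j" "fst (quotient_of (r j))" "snd (quotient_of (r j))"]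
        quotient_of_denom_pos'[of "r j"] by (simp add: D_def)
    moreover have "d = D j * (\<Prod>i\<in>UNIV - {j}. D i)"
      by (simp add: d_def prod.remove)
    ultimately have "of_nat d * r j = of_int (int (\<Prod>i\<in>UNIV - {j}. D i) * fst (quotient_of (r j)))"
      using D[of j] by (simp add: field_simps)
    then show ?thesis
      by blast
  qed
  then obtain z where z: "of_nat d * r j = of_int (z j)" for j
    by metis
  have "of_nat d * r j = of_nat (nat (z j)) - of_nat (nat (- z j))" for j
    by (cases "z j \<ge> 0") (simp_all add: z)
  moreover have "d > 0"
    using D by (simp add: d_def prod_pos)
  ultimately show ?thesis
    by (intro exI[of _ d] conjI exI[of _ "\<lambda>j. nat (z j)"] exI[of _ "\<lambda>j. nat (- z j)"] allI)
qed

lemma nondegenerate_multiple_unit_vector: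
  fixes a :: "'p::finite \<Rightarrow> nat ^ 'n"
  assumes "nondegenerate TYPE('k::field) a"
  shows "\<exists>d>0. \<exists>u v. \<forall>i. (\<Sum>j\<in>UNIV. u j * a j $ i) = (\<Sum>j\<in>UNIV. v j * a j $ i) + (if i = t then d else 0)"
proof -
  obtain r :: "'p \<Rightarrow> rat" where r: "(\<Sum>j\<in>UNIV. r j * of_nat (a j $ i)) = (if i = t then 1 else 0)" for i
    using rational_combination_unit_vector[of a t] nondegenerate_no_annihilator[OF assms] by blast
  obtain d u v where "d > 0" and uv: "\<And>j. of_nat d * r j = of_nat (u j) - of_nat (v j)"
    using common_denominator by blast
  have "(\<Sum>j\<in>UNIV. u j * a j $ i) = (\<Sum>j\<in>UNIV. v j * a j $ i) + (if i = t then d else 0)" for i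
  proof -
    have "(\<Sum>j\<in>UNIV. (of_nat (u j) - of_nat (v j)) * of_nat (a j $ i)) =
        of_nat d * (\<Sum>j\<in>UNIV. r j * of_nat (a j $ i))"
      by (simp add: sum_distrib_left mult.assoc flip: uv)
    then have "(of_nat (\<Sum>j\<in>UNIV. u j * a j $ i) :: rat) =
        of_nat ((\<Sum>j\<in>UNIV. v j * a j $ i) + (if i = t then d else 0))"
      by (auto simp: r left_diff_distrib sum_subtractf diff_eq_eq split: if_splits)
    then show ?thesis
      by (simp only: of_nat_eq_iff)
  qed
  with \<open>d > 0\<close> show ?thesis
    by blast
qed

section \<open>The ideal of a gluing\<close>

definition gluing_ideal ::
  "('p::finite \<Rightarrow> nat ^ 'n) \<Rightarrow> ('q::finite \<Rightarrow> nat ^ 'n) \<Rightarrow> ('p \<Rightarrow> nat) \<Rightarrow> ('q \<Rightarrow> nat) \<Rightarrow>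
     ('p + 'q, 'k::field) mpoly set" where
  "gluing_ideal a b \<alpha> \<beta> =
     Idl\<^bsub>mpoly_ring\<^esub> (mon_map inl_exp ` toric_ideal a) <+>\<^bsub>mpoly_ring\<^esub>
     Idl\<^bsub>mpoly_ring\<^esub> (mon_map inr_exp ` toric_ideal b) <+>\<^bsub>mpoly_ring\<^esub>
     Idl\<^bsub>mpoly_ring\<^esub> {glue_binomial \<alpha> \<beta>}"

lemma is_gluing_iff:
  "is_gluing TYPE('k::field) k1 k2 a b \<longleftrightarrow>
     (\<exists>\<alpha> \<beta>. (glue_binomial \<alpha> \<beta> :: ('p::finite + 'q::finite, 'k) mpoly) \<noteq> 0 \<and>
        (toric_ideal (glue_family k1 k2 a b) :: ('p + 'q, 'k) mpoly set) = gluing_ideal a b \<alpha> \<beta>)"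
  unfolding is_gluing_def Let_def gluing_ideal_def msubst_Inl msubst_Inr ..

lemma carrier_mpoly_ring [simp]: "carrier mpoly_ring = UNIV"
  by (simp add: ring_of_type_algebra_def)

text \<open>With a single generating set, inclusions of the ideal can be tested on
  generators.\<close>

lemma gluing_ideal_eq_genideal:
  "gluing_ideal a b \<alpha> \<beta> =
     Idl\<^bsub>mpoly_ring\<^esub> (mon_map inl_exp ` toric_ideal a \<union> mon_map inr_exp ` toric_ideal b \<union>
       {glue_binomial \<alpha> \<beta>})" (is "_ = Idl\<^bsub>?R\<^esub> (?A \<union> ?B \<union> ?C)")
proof -
  interpret cring ?R
    by (rule cring_from_type_algebra)
  have sub: "S \<subseteq> Idl\<^bsub>?R\<^esub> S" for S
    by (rule genideal_self) simp
  have ideal: "ideal (Idl\<^bsub>?R\<^esub> S) ?R" for S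
    by (rule genideal_ideal) simp
  have union: "Idl\<^bsub>?R\<^esub> (Idl\<^bsub>?R\<^esub> S \<union> Idl\<^bsub>?R\<^esub> T) = Idl\<^bsub>?R\<^esub> (S \<union> T)" for S T
  proof (rule antisym; rule genideal_minimal[OF ideal])
    have "Idl\<^bsub>?R\<^esub> S \<subseteq> Idl\<^bsub>?R\<^esub> (S \<union> T)" "Idl\<^bsub>?R\<^esub> T \<subseteq> Idl\<^bsub>?R\<^esub> (S \<union> T)"
      using sub[of "S \<union> T"] by (intro genideal_minimal[OF ideal]; blast)+
    then show "Idl\<^bsub>?R\<^esub> S \<union> Idl\<^bsub>?R\<^esub> T \<subseteq> Idl\<^bsub>?R\<^esub> (S \<union> T)"
      by blast
    show "S \<union> T \<subseteq> Idl\<^bsub>?R\<^esub> (Idl\<^bsub>?R\<^esub> S \<union> Idl\<^bsub>?R\<^esub> T)"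
      using sub[of S] sub[of T] sub[of "Idl\<^bsub>?R\<^esub> S \<union> Idl\<^bsub>?R\<^esub> T"] by blast
  qed
  show ?thesis
    unfolding gluing_ideal_def
    by (simp add: union_genideal[OF ideal ideal, symmetric] union)
qed

lemma gluing_ideal_subset:
  assumes "ideal K mpoly_ring" "mon_map inl_exp ` toric_ideal a \<subseteq> K"
    "mon_map inr_exp ` toric_ideal b \<subseteq> K" "glue_binomial \<alpha> \<beta> \<in> K"
  shows "gluing_ideal a b \<alpha> \<beta> \<subseteq> K"
  unfolding gluing_ideal_eq_genideal
  by (rule ring.genideal_minimal[OF ring_from_type_algebra assms(1)]) (use assms(2-) in auto)

text \<open>The first three facts have the shape that \<open>mon_map_kernel_binomials\<close> asks
  for; the others place the generators in the ideal.\<close>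

lemma gluing_ideal_closed:
  fixes a :: "'p::finite \<Rightarrow> nat ^ 'n" and b :: "'q::finite \<Rightarrow> nat ^ 'n" and f :: "('p, 'k::field) mpoly"
    and \<alpha> :: "'p \<Rightarrow> nat" and \<beta> :: "'q \<Rightarrow> nat"
  defines "J \<equiv> gluing_ideal a b \<alpha> \<beta> :: ('p + 'q, 'k) mpoly set"
  shows "0 \<in> J" and "g \<in> J \<Longrightarrow> h \<in> J \<Longrightarrow> g + h \<in> J" and "h \<in> J \<Longrightarrow> g * h \<in> J"
    and "f \<in> toric_ideal a \<Longrightarrow> mon_map inl_exp f \<in> J"
    and "f' \<in> toric_ideal b \<Longrightarrow> mon_map inr_exp f' \<in> J"
    and "glue_binomial \<alpha> \<beta> \<in> J"
proof -
  let ?R = "mpoly_ring :: ('p + 'q, 'k) mpoly ring"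
  interpret cring ?R
    by (rule cring_from_type_algebra)
  interpret J: ideal J ?R
    unfolding J_def gluing_ideal_eq_genideal by (rule genideal_ideal) simp
  show "0 \<in> J" "g \<in> J \<Longrightarrow> h \<in> J \<Longrightarrow> g + h \<in> J" "h \<in> J \<Longrightarrow> g * h \<in> J"
    using J.zero_closed J.a_closed[of g h] J.I_l_closed[of h g]
    by (auto simp: ring_of_type_algebra_def)
  have "mon_map inl_exp ` toric_ideal a \<union> mon_map inr_exp ` toric_ideal b \<union> {glue_binomial \<alpha> \<beta>} \<subseteq> J"
    unfolding J_def gluing_ideal_eq_genideal by (rule genideal_self) simp
  then show "f \<in> toric_ideal a \<Longrightarrow> mon_map inl_exp f \<in> J"
    "f' \<in> toric_ideal b \<Longrightarrow> mon_map inr_exp f' \<in> J" "glue_binomial \<alpha> \<beta> \<in> J"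
    by blast+
qed

text \<open>The composite exponent map factors through \<open>tdeg a\<close>, whose monomial map
  already kills \<open>f\<close>.\<close>

lemma mon_map_toric_ideal:
  assumes "f \<in> toric_ideal a" "\<And>u. \<delta> (\<epsilon> u) = g (tdeg a u)"
  shows "mon_map \<delta> (mon_map \<epsilon> f) = 0"
proof -
  have "mon_map \<delta> (mon_map \<epsilon> f) = mon_map g (mon_map (tdeg a) f)"
    by (simp add: mon_map_comp assms(2))
  with assms(1) show ?thesis
    by (simp add: toric_ideal_eq)
qed

lemma lookup_inl_exp [simp]: "Poly_Mapping.lookup (inl_exp u) (Inl i) = Poly_Mapping.lookup u i"
  "Poly_Mapping.lookup (inl_exp u) (Inr j) = 0"
  by (simp_all add: inl_exp_def)

lemma lookup_inr_exp [simp]: "Poly_Mapping.lookup (inr_exp v) (Inl i) = 0"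
  "Poly_Mapping.lookup (inr_exp v) (Inr j) = Poly_Mapping.lookup v j"
  by (simp_all add: inr_exp_def)

lemma single_one_eq_iff [simp]:
  "Poly_Mapping.single u 1 = Poly_Mapping.single v (1 :: 'k::zero_neq_one) \<longleftrightarrow> u = v"
proof
  assume "Poly_Mapping.single u 1 = Poly_Mapping.single v (1 :: 'k)"
  then have "Poly_Mapping.lookup (Poly_Mapping.single u 1) u =
      Poly_Mapping.lookup (Poly_Mapping.single v (1 :: 'k)) u"
    by simp
  then show "u = v"
    by (simp add: lookup_single when_def split: if_splits)
qed simp

lemma single_diff_mem_toric_ideal:
  "Poly_Mapping.single u 1 - Poly_Mapping.single v 1 \<in> toric_ideal a \<longleftrightarrow> tdeg a u = tdeg a v"
  by (simp add: toric_ideal_eq mon_map_diff)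

text \<open>Every binomial of the glued ideal is homogeneous for the degree given by
  \<open>l\<close> of the A-part, because the generators of the gluing ideal are.\<close>

lemma gluing_functional:
  fixes a :: "'p::finite \<Rightarrow> nat ^ 'n" and b :: "'q::finite \<Rightarrow> nat ^ 'n" and l :: "'n \<Rightarrow> int"
  assumes glue: "(toric_ideal (glue_family k1 k2 a b) :: ('p + 'q, 'k::field) mpoly set) =
      gluing_ideal a b \<alpha> \<beta>"
    and l: "(\<Sum>i\<in>UNIV. l i * int (\<Sum>j\<in>UNIV. \<alpha> j * a j $ i)) = 0"
    and deg: "\<And>i. k1 * (\<Sum>j\<in>UNIV. u j * a j $ i) + k2 * (\<Sum>j\<in>UNIV. v j * b j $ i) =
      k1 * (\<Sum>j\<in>UNIV. u' j * a j $ i) + k2 * (\<Sum>j\<in>UNIV. v' j * b j $ i)"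
  shows "(\<Sum>i\<in>UNIV. l i * int (\<Sum>j\<in>UNIV. u j * a j $ i)) =
    (\<Sum>i\<in>UNIV. l i * int (\<Sum>j\<in>UNIV. u' j * a j $ i))"
proof -
  define \<delta> :: "('p + 'q \<Rightarrow>\<^sub>0 nat) \<Rightarrow> int" where
    "\<delta> w = (\<Sum>i\<in>UNIV. l i * int (\<Sum>j\<in>UNIV. Poly_Mapping.lookup w (Inl j) * a j $ i))" for w
  let ?K = "{f :: ('p + 'q, 'k) mpoly. mon_map \<delta> f = 0}"
  let ?w = "mexp (case_sum u v)" and ?w' = "mexp (case_sum u' v')"
  have \<delta>_add: "\<delta> (w + w') = \<delta> w + \<delta> w'" for w w'
    by (simp add: \<delta>_def lookup_add distrib_left distrib_right sum.distrib)
  have "gluing_ideal a b \<alpha> \<beta> \<subseteq> ?K"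
  proof (rule gluing_ideal_subset)
    show "ideal ?K mpoly_ring"
      by (rule ideal_mon_map_kernel) (rule \<delta>_add)
    show "mon_map inl_exp ` toric_ideal a \<subseteq> ?K"
      by (auto intro!: mon_map_toric_ideal[where g = "\<lambda>e. \<Sum>i\<in>UNIV. l i * int (Poly_Mapping.lookup e i)"]
          simp: \<delta>_def tdeg_def)
    \<comment> \<open>The variables of \<open>b\<close> have degree 0, so an element is sent to the
      sum of its coefficients, which is 0 on the toric ideal.\<close>
    show "mon_map inr_exp ` toric_ideal b \<subseteq> ?K"
      by (auto intro!: mon_map_toric_ideal[where g = "\<lambda>_. 0"] simp: \<delta>_def)
    show "glue_binomial \<alpha> \<beta> \<in> ?K"
      using l by (simp add: glue_binomial_eq mon_map_diff \<delta>_def)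
  qed
  moreover have "tdeg (glue_family k1 k2 a b) ?w = tdeg (glue_family k1 k2 a b) ?w'"
    by (rule poly_mapping_eqI) (simp add: lookup_tdeg_glue deg)
  then have "(Poly_Mapping.single ?w 1 - Poly_Mapping.single ?w' 1 :: ('p + 'q, 'k) mpoly) \<in>
      toric_ideal (glue_family k1 k2 a b)"
    by (simp add: single_diff_mem_toric_ideal)
  ultimately have "\<delta> ?w = \<delta> ?w'"
    unfolding glue by (auto simp: mon_map_diff)
  then show ?thesis
    by (simp add: \<delta>_def)
qed

lemma functional_vanishing_on_vector:
  fixes g :: "'n::finite \<Rightarrow> int"
  assumes "CARD('n) \<noteq> 1"
  shows "\<exists>(l :: 'n \<Rightarrow> int) t. (\<Sum>i\<in>UNIV. l i * g i) = 0 \<and> l t \<noteq> 0"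
proof -
  obtain s t :: 'n where "s \<noteq> t"
    using assms by (metis (full_types) UNIV_I card_1_singleton_iff One_nat_def insertI1 singletonD subsetI subset_antisym)
  \<comment> \<open>The functional \<open>g t * x s - g s * x t\<close> vanishes on
    \<open>g\<close>; if both coefficients are 0, the coordinate \<open>s\<close> does.\<close>
  define l where "l i = (if g s = 0 \<and> g t = 0 then if i = s then 1 else 0
      else if i = s then g t else if i = t then - g s else 0)" for i
  have "(\<Sum>i\<in>UNIV. l i * g i) = (\<Sum>i\<in>{s, t}. l i * g i)"
    by (rule sum.mono_neutral_right) (auto simp: l_def)
  also have "\<dots> = 0"
    using \<open>s \<noteq> t\<close> by (auto simp: l_def)
  finally show ?thesis
    using \<open>s \<noteq> t\<close> by (metis l_def neg_equal_0_iff_equal zero_neq_one)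
qed

lemma not_glued:
  fixes a :: "'p::finite \<Rightarrow> nat ^ 'n" and b :: "'q::finite \<Rightarrow> nat ^ 'n"
  assumes "nondegenerate TYPE('k::field) a" "nondegenerate TYPE('k) b" "CARD('n) \<noteq> 1"
  shows "\<not> can_be_glued TYPE('k) a b"
proof
  assume "can_be_glued TYPE('k) a b"
  then obtain k1 k2 \<alpha> \<beta> where k: "k1 > 0" "k2 > 0" and
    glue: "(toric_ideal (glue_family k1 k2 a b) :: ('p + 'q, 'k) mpoly set) = gluing_ideal a b \<alpha> \<beta>"
    unfolding can_be_glued_def is_gluing_iff by blast
  obtain l :: "'n \<Rightarrow> int" and t
    where l: "(\<Sum>i\<in>UNIV. l i * int (\<Sum>j\<in>UNIV. \<alpha> j * a j $ i)) = 0" "l t \<noteq> 0"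
    using functional_vanishing_on_vector[OF assms(3), of "\<lambda>i. int (\<Sum>j\<in>UNIV. \<alpha> j * a j $ i)"] by blast
  obtain d u u' where "d > 0" and A: "\<And>i. (\<Sum>j\<in>UNIV. u j * a j $ i) =
      (\<Sum>j\<in>UNIV. u' j * a j $ i) + (if i = t then d else 0)"
    using nondegenerate_multiple_unit_vector[OF assms(1)] by blast
  obtain e v v' where "e > 0" and B: "\<And>i. (\<Sum>j\<in>UNIV. v j * b j $ i) =
      (\<Sum>j\<in>UNIV. v' j * b j $ i) + (if i = t then e else 0)"
    using nondegenerate_multiple_unit_vector[OF assms(2)] by blast
  have scale: "(\<Sum>j\<in>UNIV. m * w j * c j $ i) = m * (\<Sum>j\<in>UNIV. w j * c j $ i)"
    for m :: nat and w and c :: "'x::finite \<Rightarrow> nat ^ 'n" and i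
    by (simp add: sum_distrib_left mult.assoc)
  \<comment> \<open>The multiples are chosen so that \<open>k1 * k2 * d * e\<close> times the unit
    vector \<open>t\<close> moves from the A-part to the B-part without changing the total
    degree.\<close>
  have "(\<Sum>i\<in>UNIV. l i * int (\<Sum>j\<in>UNIV. k2 * e * u j * a j $ i)) =
    (\<Sum>i\<in>UNIV. l i * int (\<Sum>j\<in>UNIV. k2 * e * u' j * a j $ i))"
    by (rule gluing_functional[OF glue l(1), where v = "\<lambda>j. k1 * d * v' j" and v' = "\<lambda>j. k1 * d * v j"])
      (simp only: scale A B, simp add: algebra_simps)
  \<comment> \<open>The A-parts nevertheless differ by \<open>k2 * e * d\<close> in coordinate
    \<open>t\<close>, where \<open>l\<close> is nonzero.\<close>
  moreover have "(\<Sum>i\<in>UNIV. l i * int (\<Sum>j\<in>UNIV. k2 * e * u j * a j $ i)) =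
      (\<Sum>i\<in>UNIV. l i * int (\<Sum>j\<in>UNIV. k2 * e * u' j * a j $ i)) +
      (\<Sum>i\<in>UNIV. if i = t then l i * int (k2 * e * d) else 0)"
    unfolding scale A by (subst sum.distrib[symmetric], rule sum.cong) (auto simp: algebra_simps)
  ultimately show False
    using l(2) k \<open>d > 0\<close> \<open>e > 0\<close> by simp
qed

section \<open>Gluing numerical semigroups\<close>

text \<open>Bezout's identity for a finite family, by induction over the integers; the negative
  coefficients then move to the other side.\<close>

lemma gcd_combination:
  fixes x :: "'p \<Rightarrow> nat"
  assumes "finite S"
  shows "\<exists>u v. (\<Sum>j\<in>S. u j * x j) = (\<Sum>j\<in>S. v j * x j) + Gcd (x ` S)"
proof -
  have "\<exists>z. (\<Sum>j\<in>S. z j * int (x j)) = int (Gcd (x ` S))"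
    using assms
  proof (induction S rule: finite_induct)
    case (insert i S)
    then obtain z where z: "(\<Sum>j\<in>S. z j * int (x j)) = int (Gcd (x ` S))"
      by blast
    obtain p q where pq: "p * int (x i) + q * int (Gcd (x ` S)) = gcd (int (x i)) (int (Gcd (x ` S)))"
      using bezout_int by blast
    have "(\<Sum>j\<in>S. ((\<lambda>j. q * z j)(i := p)) j * int (x j)) = (\<Sum>j\<in>S. q * (z j * int (x j)))"
      using insert.hyps by (intro sum.cong) auto
    then have "(\<Sum>j\<in>insert i S. ((\<lambda>j. q * z j)(i := p)) j * int (x j)) =
        p * int (x i) + q * int (Gcd (x ` S))"
      using insert.hyps by (simp add: z flip: sum_distrib_left)
    then show ?case
      unfolding pq by (intro exI[of _ "(\<lambda>j. q * z j)(i := p)"]) simp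
  qed simp
  then obtain z where z: "(\<Sum>j\<in>S. z j * int (x j)) = int (Gcd (x ` S))"
    by blast
  have "z j * int (x j) = int (nat (z j) * x j) - int (nat (- z j) * x j)" for j
    by (cases "z j \<ge> 0") simp_all
  then have "int (\<Sum>j\<in>S. nat (z j) * x j) = int ((\<Sum>j\<in>S. nat (- z j) * x j) + Gcd (x ` S))"
    using z by (simp add: sum_subtractf)
  then show ?thesis
    unfolding of_nat_eq_iff by (intro exI)
qed

lemma inl_exp_add: "inl_exp (u + v) = inl_exp u + inl_exp v"
  by (rule poly_mapping_eqI) (simp add: lookup_add inl_exp_def split: sum.split)

lemma inr_exp_add: "inr_exp (u + v) = inr_exp u + inr_exp v"
  by (rule poly_mapping_eqI) (simp add: lookup_add inr_exp_def split: sum.split)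

lemma exp_sum_decomp:
  "w = inl_exp (mexp (\<lambda>i. Poly_Mapping.lookup w (Inl i))) + inr_exp (mexp (\<lambda>j. Poly_Mapping.lookup w (Inr j)))"
  by (rule poly_mapping_eqI) (simp add: lookup_add inl_exp_def inr_exp_def split: sum.split)

lemma diff_dvd_power_diff: "x - y dvd x ^ m - (y ^ m :: 'r::comm_ring_1)"
proof (cases m)
  case (Suc k)
  then show ?thesis
    by (metis diff_power_eq_sum dvd_triv_left)
qed simp

text \<open>Moving \<open>m\<close> copies of \<open>\<alpha>\<close> from the \<open>A\<close>-part to the \<open>B\<close>-part costs a multiple of the binomial
  \<open>\<rho>\<close>; the remaining changes happen inside \<open>A\<close> and inside \<open>B\<close>.\<close>

lemma binomial_mem_gluing_ideal:
  fixes a :: "'p::finite \<Rightarrow> nat ^ 'n" and b :: "'q::finite \<Rightarrow> nat ^ 'n"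
  assumes A: "\<And>i. (\<Sum>j\<in>UNIV. Poly_Mapping.lookup w (Inl j) * a j $ i) =
      (\<Sum>j\<in>UNIV. Poly_Mapping.lookup w' (Inl j) * a j $ i) + m * (\<Sum>j\<in>UNIV. \<alpha> j * a j $ i)"
    and B: "\<And>i. (\<Sum>j\<in>UNIV. Poly_Mapping.lookup w' (Inr j) * b j $ i) =
      (\<Sum>j\<in>UNIV. Poly_Mapping.lookup w (Inr j) * b j $ i) + m * (\<Sum>j\<in>UNIV. \<beta> j * b j $ i)"
  shows "Poly_Mapping.single w 1 - Poly_Mapping.single w' 1 \<in>
    (gluing_ideal a b \<alpha> \<beta> :: ('p + 'q, 'k::field) mpoly set)"
proof -
  let ?J = "gluing_ideal a b \<alpha> \<beta> :: ('p + 'q, 'k) mpoly set"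
  define x :: "('p \<Rightarrow>\<^sub>0 nat) \<Rightarrow> ('p + 'q, 'k) mpoly" where "x u = Poly_Mapping.single (inl_exp u) 1" for u
  define y :: "('q \<Rightarrow>\<^sub>0 nat) \<Rightarrow> ('p + 'q, 'k) mpoly" where "y v = Poly_Mapping.single (inr_exp v) 1" for v
  define u where "u = mexp (\<lambda>i. Poly_Mapping.lookup w (Inl i))"
  define v where "v = mexp (\<lambda>j. Poly_Mapping.lookup w (Inr j))"
  define u' where "u' = mexp (\<lambda>i. Poly_Mapping.lookup w' (Inl i))"
  define v' where "v' = mexp (\<lambda>j. Poly_Mapping.lookup w' (Inr j))"
  define p where "p = mexp (\<lambda>i. m * \<alpha> i)"
  define q where "q = mexp (\<lambda>j. m * \<beta> j)"
  have x_add: "x (s + t) = x s * x t" for s t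
    by (simp add: x_def inl_exp_add mult_single)
  have y_add: "y (s + t) = y s * y t" for s t
    by (simp add: y_def inr_exp_add mult_single)
  have w: "Poly_Mapping.single w 1 = x u * y v" "Poly_Mapping.single w' 1 = x u' * y v'"
    unfolding x_def y_def mult_single u_def v_def u'_def v'_def
    by (simp_all flip: exp_sum_decomp)
  have "tdeg a u = tdeg a (u' + p)"
    by (rule poly_mapping_eqI)
      (simp add: tdeg_def u_def u'_def p_def lookup_add A distrib_right sum.distrib sum_distrib_left mult.assoc)
  then have x_mem: "x u - x (u' + p) \<in> ?J"
    using gluing_ideal_closed(4)[of "Poly_Mapping.single u 1 - Poly_Mapping.single (u' + p) 1" a b \<alpha> \<beta>]
    by (simp add: single_diff_mem_toric_ideal mon_map_diff x_def)
  have "tdeg b v' = tdeg b (v + q)"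
    by (rule poly_mapping_eqI)
      (simp add: tdeg_def v_def v'_def q_def lookup_add B distrib_right sum.distrib sum_distrib_left mult.assoc)
  then have y_mem: "y (v + q) - y v' \<in> ?J"
    using gluing_ideal_closed(5)[of "Poly_Mapping.single (v + q) 1 - Poly_Mapping.single v' 1" b a \<alpha> \<beta>]
    by (simp add: single_diff_mem_toric_ideal mon_map_diff y_def)
  \<comment> \<open>\<open>x p\<close> and \<open>y q\<close> are the \<open>m\<close>-th powers of
    the two monomials of \<rho>, so \<rho> divides their difference.\<close>
  have "x p = x (mexp \<alpha>) ^ m" "y q = y (mexp \<beta>) ^ m"
    by (simp_all add: x_def y_def p_def q_def inl_exp_def inr_exp_def single_mexp_power)
      (auto simp: fun_eq_iff split: sum.split)
  then have "glue_binomial \<alpha> \<beta> dvd x p - y q"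
    by (simp add: glue_binomial_eq x_def y_def diff_dvd_power_diff)
  then obtain g where "x p - y q = g * glue_binomial \<alpha> \<beta>"
    by (metis dvdE mult.commute)
  then have xy_mem: "x p - y q \<in> ?J"
    by (simp add: gluing_ideal_closed(3,6))
  \<comment> \<open>Telescopes along \<open>x u * y v\<close>, \<open>x (u' + p) * y v\<close>,
    \<open>x u' * y (v + q)\<close>, \<open>x u' * y v'\<close>.\<close>
  have "Poly_Mapping.single w 1 - Poly_Mapping.single w' 1 =
      y v * (x u - x (u' + p)) + (x u' * y v) * (x p - y q) + x u' * (y (v + q) - y v')"
    by (simp add: w x_add y_add algebra_simps)
  also have "\<dots> \<in> ?J"
    by (intro gluing_ideal_closed(2,3) x_mem y_mem xy_mem)
  finally show ?thesis .
qed

text \<open>The glued degree restricts to \<open>k1\<close> times the degree of \<open>a\<close> and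
  \<open>k2\<close> times that of \<open>b\<close>, and the hypothesis says that the two monomials
  of \<rho> have the same degree.\<close>

lemma gluing_ideal_subset_toric_ideal:
  fixes a :: "'p::finite \<Rightarrow> nat ^ 'n" and b :: "'q::finite \<Rightarrow> nat ^ 'n"
  assumes "\<And>i. k1 * (\<Sum>j\<in>UNIV. \<alpha> j * a j $ i) = k2 * (\<Sum>j\<in>UNIV. \<beta> j * b j $ i)"
  shows "(gluing_ideal a b \<alpha> \<beta> :: ('p + 'q, 'k::field) mpoly set) \<subseteq> toric_ideal (glue_family k1 k2 a b)"
proof (rule gluing_ideal_subset[OF ideal_toric_ideal])
  have "tdeg (glue_family k1 k2 a b) (inl_exp u) = mexp (\<lambda>i. k1 * Poly_Mapping.lookup (tdeg a u) i)" for u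
    by (rule poly_mapping_eqI) (simp add: lookup_tdeg_glue, simp add: tdeg_def)
  then show "mon_map inl_exp ` toric_ideal a \<subseteq> (toric_ideal (glue_family k1 k2 a b) :: ('p + 'q, 'k) mpoly set)"
    unfolding toric_ideal_eq[of "glue_family k1 k2 a b"]
    by (auto intro!: mon_map_toric_ideal[where g = "\<lambda>e. mexp (\<lambda>i. k1 * Poly_Mapping.lookup e i)"])
  have "tdeg (glue_family k1 k2 a b) (inr_exp v) = mexp (\<lambda>i. k2 * Poly_Mapping.lookup (tdeg b v) i)" for v
    by (rule poly_mapping_eqI) (simp add: lookup_tdeg_glue, simp add: tdeg_def)
  then show "mon_map inr_exp ` toric_ideal b \<subseteq> (toric_ideal (glue_family k1 k2 a b) :: ('p + 'q, 'k) mpoly set)"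
    unfolding toric_ideal_eq[of "glue_family k1 k2 a b"]
    by (auto intro!: mon_map_toric_ideal[where g = "\<lambda>e. mexp (\<lambda>i. k2 * Poly_Mapping.lookup e i)"])
  have "tdeg (glue_family k1 k2 a b) (inl_exp (mexp \<alpha>)) = tdeg (glue_family k1 k2 a b) (inr_exp (mexp \<beta>))"
    by (rule poly_mapping_eqI) (simp add: lookup_tdeg_glue assms)
  then show "glue_binomial \<alpha> \<beta> \<in> (toric_ideal (glue_family k1 k2 a b) :: ('p + 'q, 'k) mpoly set)"
    by (simp add: glue_binomial_eq single_diff_mem_toric_ideal)
qed

text \<open>The choice is \<open>k1 = dB s\<close> and \<open>k2 = dA (s e + 1)\<close>, where \<open>dA\<close> and \<open>dB\<close> are the gcds of the two
  families: as \<open>s\<close> and \<open>s e + 1\<close> are coprime, \<open>k1 x = k2 y\<close> with \<open>dA dvd x\<close> and \<open>dB dvd y\<close> forces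
  \<open>x = m k2\<close> and \<open>y = m k1\<close>.\<close>

lemma can_be_glued_dim_1:
  fixes a :: "'p::finite \<Rightarrow> nat ^ 'n" and b :: "'q::finite \<Rightarrow> nat ^ 'n"
  assumes a0: "\<forall>j. a j \<noteq> 0" and b0: "\<forall>j. b j \<noteq> 0" and "CARD('n) = 1"
  shows "can_be_glued TYPE('k::field) a b"
proof -
  obtain t :: 'n where UNIV_t: "UNIV = {t}"
    using assms(3) by (metis card_1_singletonE)
  then have all_t: "i = t" for i
    by blast
  have pos: "a j $ t > 0" "b l $ t > 0" for j l
    using a0 b0 all_t by (metis gr0I vec_eq_iff zero_index)+
  define dA where "dA = Gcd (range (\<lambda>j. a j $ t))"
  define dB where "dB = Gcd (range (\<lambda>j. b j $ t))"
  have dA_dvd: "dA dvd a j $ t" and dB_dvd: "dB dvd b l $ t" for j l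
    by (simp_all add: dA_def dB_def)
  then have "dA > 0" "dB > 0"
    using pos by (metis dvd_0_left_iff gr0I less_irrefl)+
  obtain u v where uv: "(\<Sum>j\<in>UNIV. u j * a j $ t) = (\<Sum>j\<in>UNIV. v j * a j $ t) + dA"
    using gcd_combination[of UNIV "\<lambda>j. a j $ t"] unfolding dA_def by auto
  \<comment> \<open>Any index serves. \<open>k1\<close> is a single element of B, so that
    \<open>\<beta>\<close> is a unit vector.\<close>
  define j0 :: 'q where "j0 = undefined"
  define k1 where "k1 = b j0 $ t"
  define \<beta> where "\<beta> j = (if j = j0 then 1 else 0 :: nat)" for j
  obtain s where s: "k1 = dB * s"
    using dB_dvd[of j0] unfolding k1_def by (metis dvdE)
  have "k1 > 0"
    using pos by (simp add: k1_def)
  with s have "s > 0"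
    by (cases s) auto
  \<comment> \<open>With the sums \<open>dA * e\<close> for \<open>v\<close> and
    \<open>dA * (e + 1)\<close> for \<open>u\<close>, this combination has the sum
    \<open>dA * (s * e + 1)\<close>.\<close>
  define \<alpha> where "\<alpha> j = (s - 1) * v j + u j" for j
  define k2 where "k2 = (\<Sum>j\<in>UNIV. \<alpha> j * a j $ t)"
  have k1: "(\<Sum>j\<in>UNIV. \<beta> j * b j $ t) = k1"
    by (simp add: \<beta>_def k1_def if_distrib[of "\<lambda>x. x * _"] cong: if_cong)
  have dvd_sum: "dA dvd (\<Sum>j\<in>UNIV. w j * a j $ t)" "dB dvd (\<Sum>j\<in>UNIV. w' j * b j $ t)" for w w'
    using dA_dvd dB_dvd by (auto intro!: dvd_sum dvd_mult)
  obtain e where e: "(\<Sum>j\<in>UNIV. v j * a j $ t) = dA * e"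
    using dvd_sum(1) by (metis dvdE)
  have "k2 = (s - 1) * (\<Sum>j\<in>UNIV. v j * a j $ t) + (\<Sum>j\<in>UNIV. u j * a j $ t)"
    by (simp add: k2_def \<alpha>_def distrib_right sum.distrib sum_distrib_left mult.assoc)
  also have "\<dots> = dA * ((s - 1) * e + e + 1)"
    by (simp add: uv e algebra_simps)
  also have "(s - 1) * e + e = s * e"
    using \<open>s > 0\<close> by (cases s) auto
  finally have k2: "k2 = dA * (s * e + 1)" .
  have "coprime s (s * e + 1)"
    by (metis coprime_1_right coprime_iff_gcd_eq_1 gcd_add_mult mult.commute add.commute)
  have split: "\<exists>m. x = m * k2 \<and> y = m * k1" if eq: "k1 * x = k2 * y" and dvd: "dA dvd x" "dB dvd y" for x y
  proof -
    obtain x' y' where xy: "x = dA * x'" "y = dB * y'"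
      using dvd by (metis dvdE)
    then have "(dA * dB) * (s * x') = (dA * dB) * ((s * e + 1) * y')"
      using eq unfolding s k2 by (simp only: mult_ac)
    then have sX: "s * x' = (s * e + 1) * y'"
      using \<open>dA > 0\<close> \<open>dB > 0\<close> by (metis mult_cancel1 mult_eq_0_iff less_irrefl)
    then have "s * e + 1 dvd s * x'"
      by (metis dvd_triv_left)
    then have "s * e + 1 dvd x'"
      using \<open>coprime s (s * e + 1)\<close> by (metis coprime_commute coprime_dvd_mult_right_iff)
    then obtain m where m: "x' = (s * e + 1) * m"
      by (metis dvdE)
    with sX have "(s * e + 1) * (s * m) = (s * e + 1) * y'"
      by (simp only: mult_ac)
    then have "y' = s * m"
      by (metis Suc_eq_plus1 Suc_mult_cancel1)
    with m xy show ?thesis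
      by (intro exI[of _ m]) (simp add: s k2 algebra_simps)
  qed
  have "k2 > 0"
    using \<open>dA > 0\<close> by (simp add: k2)
  let ?J = "gluing_ideal a b \<alpha> \<beta> :: ('p + 'q, 'k) mpoly set"
  let ?I = "toric_ideal (glue_family k1 k2 a b) :: ('p + 'q, 'k) mpoly set"
  \<comment> \<open>Fixing which A-part is larger makes the natural-number differences below exact:
    the B-part of \<open>w'\<close> is then the larger one.\<close>
  have binom: "Poly_Mapping.single w 1 - Poly_Mapping.single w' 1 \<in> ?J"
    if eq: "tdeg (glue_family k1 k2 a b) w = tdeg (glue_family k1 k2 a b) w'"
      and le: "(\<Sum>j\<in>UNIV. Poly_Mapping.lookup w' (Inl j) * a j $ t) \<le> (\<Sum>j\<in>UNIV. Poly_Mapping.lookup w (Inl j) * a j $ t)"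
      (is "?A' \<le> ?A")
    for w w'
  proof -
    let ?B = "\<Sum>j\<in>UNIV. Poly_Mapping.lookup w (Inr j) * b j $ t"
    let ?B' = "\<Sum>j\<in>UNIV. Poly_Mapping.lookup w' (Inr j) * b j $ t"
    have deg: "k1 * ?A + k2 * ?B = k1 * ?A' + k2 * ?B'"
      using arg_cong[OF eq, of "\<lambda>e. Poly_Mapping.lookup e t"] by (simp only: lookup_tdeg_glue)
    have "k1 * ?A' \<le> k1 * ?A"
      using le by simp
    with deg have "k2 * ?B \<le> k2 * ?B'"
      by linarith
    then have leB: "?B \<le> ?B'"
      using \<open>k2 > 0\<close> by simp
    have "k1 * (?A - ?A') = k2 * (?B' - ?B)"
      using deg by (simp add: diff_mult_distrib2)
    from split[OF this dvd_diff_nat[OF dvd_sum(1) dvd_sum(1)] dvd_diff_nat[OF dvd_sum(2) dvd_sum(2)]]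
    obtain m where "?A - ?A' = m * k2" "?B' - ?B = m * k1"
      by blast
    with le leB have m: "?A = ?A' + m * k2" "?B' = ?B + m * k1"
      by linarith+
    show ?thesis
    proof (rule binomial_mem_gluing_ideal)
      fix i
      show "(\<Sum>j\<in>UNIV. Poly_Mapping.lookup w (Inl j) * a j $ i) =
          (\<Sum>j\<in>UNIV. Poly_Mapping.lookup w' (Inl j) * a j $ i) + m * (\<Sum>j\<in>UNIV. \<alpha> j * a j $ i)"
        unfolding all_t[of i] using m(1) by (simp only: k2_def)
      show "(\<Sum>j\<in>UNIV. Poly_Mapping.lookup w' (Inr j) * b j $ i) =
          (\<Sum>j\<in>UNIV. Poly_Mapping.lookup w (Inr j) * b j $ i) + m * (\<Sum>j\<in>UNIV. \<beta> j * b j $ i)"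
        unfolding all_t[of i] using m(2) by (simp only: k1)
    qed
  qed
  have "?I = ?J"
  proof
    show "?J \<subseteq> ?I"
    proof (rule gluing_ideal_subset_toric_ideal)
      fix i
      show "k1 * (\<Sum>j\<in>UNIV. \<alpha> j * a j $ i) = k2 * (\<Sum>j\<in>UNIV. \<beta> j * b j $ i)"
        unfolding all_t[of i] by (simp add: k1 flip: k2_def)
    qed
    show "?I \<subseteq> ?J"
    proof
      fix f
      assume "f \<in> ?I"
      then have "mon_map (tdeg (glue_family k1 k2 a b)) f = 0"
        by (simp add: toric_ideal_eq)
      then show "f \<in> ?J"
      proof (rule mon_map_kernel_binomials[rotated -1])
        fix w w'
        assume eq: "tdeg (glue_family k1 k2 a b) w = tdeg (glue_family k1 k2 a b) w'"
        \<comment> \<open>In the opposite order \<open>binom\<close> yields the negative of the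
          binomial.\<close>
        have "Poly_Mapping.single w 1 - Poly_Mapping.single w' 1 \<in> ?J \<or>
            Poly_Mapping.single w' 1 - Poly_Mapping.single w 1 \<in> ?J"
          using binom[OF eq] binom[OF eq[symmetric]] by (meson nat_le_linear)
        then show "Poly_Mapping.single w 1 - Poly_Mapping.single w' 1 \<in> ?J"
          using gluing_ideal_closed(3)[of "Poly_Mapping.single w' 1 - Poly_Mapping.single w 1" a b \<alpha> \<beta> "- 1"]
          by auto
      qed (fact gluing_ideal_closed)+
    qed
  qed
  moreover have "(glue_binomial \<alpha> \<beta> :: ('p + 'q, 'k) mpoly) \<noteq> 0"
  proof -
    have "Poly_Mapping.lookup (inl_exp (mexp \<alpha>) :: 'p + 'q \<Rightarrow>\<^sub>0 nat) (Inr j0) \<noteq>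
        Poly_Mapping.lookup (inr_exp (mexp \<beta>)) (Inr j0)"
      by (simp add: \<beta>_def)
    then have "(inl_exp (mexp \<alpha>) :: 'p + 'q \<Rightarrow>\<^sub>0 nat) \<noteq> inr_exp (mexp \<beta>)"
      by metis
    then show ?thesis
      by (simp add: glue_binomial_eq)
  qed
  ultimately show ?thesis
    unfolding can_be_glued_def is_gluing_iff using \<open>k1 > 0\<close> \<open>k2 > 0\<close> by blast
qed

theorem theorem2p2:
  fixes a :: "'p::finite \<Rightarrow> nat ^ 'n" and b :: "'q::finite \<Rightarrow> nat ^ 'n"
  assumes "\<forall>j. a j \<noteq> 0" and "\<forall>j. b j \<noteq> 0"
    and "nondegenerate TYPE('k::field) a" and "nondegenerate TYPE('k) b"
    and "cohen_macaulay (semigroup_ring a :: ('p, 'k) mpoly set ring)"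
    and "cohen_macaulay (semigroup_ring b :: ('q, 'k) mpoly set ring)"
  shows "can_be_glued TYPE('k) a b \<longleftrightarrow> CARD('n) = 1"
  using not_glued[OF assms(3,4)] can_be_glued_dim_1[OF assms(1,2)] by blast

end
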